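(* Let $K \subset \mathbb{R}^d$ be closed and convex. Let $T_K$ be the set of pairs $(v,w) \in S^{d-1}\times S^{d-1}$ for which there exists a nondegenerate line segment $\tau \subset \partial K$ with direction $v$ that lies in a supporting hyperplane of $K$ with outward normal direction $w$. Then $T_K$, regarded as a subset of $\mathbb{R}^d\times\mathbb{R}^d=\mathbb{R}^{2d}$, has $\sigma$-finite $(d-2)$-dimensional Minkowski content.
   Context: For $S\subset \mathbb{R}^n$ the $m$-dimensional upper Minkowski content is $\mathcal{M}^{*m}(S)=\limsup_{\varepsilon\downarrow 0}(2\varepsilon)^{m-n}\operatorname{Vol}(S_\varepsilon)$, where $S_\varepsilon$ is the set of points of $\mathbb{R}^n$ within distance $\varepsilon$ of $S$ and $\operatorname{Vol}$ is $n$-dimensional Lebesgue measure. $S$ has finite $m$-content (finite $m$-dimensional Minkowski content) if $\mathcal{M}^{*m}(S)<\infty$, and $\sigma$-finite $m$-dimensional Minkowski content if it is a countable union of sets of finite $m$-content. $S^{d-1}$ is the unit sphere of $\mathbb{R}^d$; $\partial K$ is the topological boundary of $K$. *)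

theory Defs
  imports "HOL-Analysis.Analysis"
begin

text \<open>The guard \<open>S \<noteq> {}\<close> is needed since \<^term>\<open>infdist x {} = 0\<close>. The sets below are closed,
  hence measurable; the strict inequality would give the same Minkowski content.\<close>

definition parallel_set :: "'a::euclidean_space set \<Rightarrow> real \<Rightarrow> 'a set" where
  "parallel_set S \<epsilon> = {x. S \<noteq> {} \<and> infdist x S \<le> \<epsilon>}"

text \<open>The dimension \<open>m\<close> is real-valued, so that \<open>d - 2\<close> needs no truncated subtraction when
  \<open>d = 1\<close>.\<close>

definition upper_minkowski_content :: "real \<Rightarrow> 'a::euclidean_space set \<Rightarrow> ennreal" where
  "upper_minkowski_content m S =
     Limsup (at_right 0)
       (\<lambda>\<epsilon>. ennreal ((2 * \<epsilon>) powr (m - real DIM('a))) * emeasure lebesgue (parallel_set S \<epsilon>))"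

definition finite_minkowski_content :: "real \<Rightarrow> 'a::euclidean_space set \<Rightarrow> bool" where
  "finite_minkowski_content m S \<longleftrightarrow> upper_minkowski_content m S < \<infinity>"

definition sigma_finite_minkowski_content :: "real \<Rightarrow> 'a::euclidean_space set \<Rightarrow> bool" where
  "sigma_finite_minkowski_content m S \<longleftrightarrow>
     (\<exists>\<A>. countable \<A> \<and> (\<forall>A\<in>\<A>. finite_minkowski_content m A) \<and> S = \<Union>\<A>)"

text \<open>\<open>H\<close> is a supporting hyperplane of \<open>K\<close> with outward normal direction \<open>w\<close>.\<close>

definition supporting_hyperplane ::
    "'a::euclidean_space set \<Rightarrow> 'a \<Rightarrow> 'a set \<Rightarrow> bool" where
  "supporting_hyperplane K w H \<longleftrightarrow>
     w \<noteq> 0 \<and> (\<exists>h. H = {x. w \<bullet> x = h} \<and> K \<subseteq> {x. w \<bullet> x \<le> h}) \<and> H \<inter> K \<noteq> {}"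

text \<open>A segment has both unit vectors along it as directions, because \<open>a\<close> and \<open>b\<close> may be
  exchanged.\<close>

definition segment_direction :: "'a::euclidean_space set \<Rightarrow> 'a \<Rightarrow> bool" where
  "segment_direction \<tau> v \<longleftrightarrow>
     (\<exists>a b. a \<noteq> b \<and> \<tau> = closed_segment a b \<and> v = (b - a) /\<^sub>R norm (b - a))"

definition boundary_segment_pairs :: "'a::euclidean_space set \<Rightarrow> ('a \<times> 'a) set" where
  "boundary_segment_pairs K =
     {(v, w). v \<in> sphere 0 1 \<and> w \<in> sphere 0 1 \<and>
        (\<exists>\<tau> H. segment_direction \<tau> v \<and> \<tau> \<subseteq> frontier K \<and>
               supporting_hyperplane K w H \<and> \<tau> \<subseteq> H)}"

end

theory Submission
  imports Defs
begin

text \<open>A segment in the boundary that has direction \<open>v\<close> and lies in a supporting hyperplane with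
normal \<open>\<omega>\<close> crosses two hyperplanes \<open>{x. x \<bullet> e = p}\<close> and \<open>{x. x \<bullet> e = q}\<close>, for some basis
vector \<open>e\<close> and rational \<open>p \<noteq> q\<close>.  This gives a countable decomposition of \<open>T_K\<close>, and it is enough to
treat one choice of \<open>e, p, q\<close> and one bound \<open>R\<close> on the crossing points.  Let \<open>K0\<close> and \<open>K1\<close> be the
corresponding bounded slices of \<open>K\<close>.  The crossing points \<open>a \<in> K0\<close> and \<open>b \<in> K1\<close> both maximise the
linear form of the unit vector \<open>w \<bottom> e\<close> obtained by normalising the projection of \<open>\<omega>\<close>, and
\<open>(v, \<omega>)\<close> is a Lipschitz function of \<open>(b - a, w)\<close>.  The claim becomes a counting statement: at scale
\<open>\<eta>\<close> there are \<open>O(\<eta> powr (2 - d))\<close> separated pairs \<open>(b - a, w)\<close>.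

Monotonicity of normals makes \<open>a + b\<close> and \<open>w\<close> Lipschitz functions of \<open>a + b + w\<close>, but the
difference \<open>b - a\<close> need not be a Lipschitz or even a single-valued function of it.  The
remedy, in the spirit of Ewald, Larman and Rogers, is to compare volumes of caps.  Put
\<open>C = K0 + K1 + E\<close>, where \<open>E\<close> is a cylinder of radius 1 and half-height \<open>\<eta>\<close> with axis \<open>e\<close>, so that
\<open>a + b + w\<close> is a boundary point of \<open>C\<close> with normal \<open>w\<close>, and consider the caps of \<open>C\<close> of width
\<open>\<eta>\<^sup>2\<close> at these points.  Three facts make the count work.

\<^item> The caps lie in a layer near the boundary of volume \<open>O(\<eta>\<^sup>2)\<close> times the volume \<open>O(\<eta>)\<close> of \<open>C\<close>
  (\<open>measure_caps_le\<close>, \<open>measure_slab_le\<close>), and all of them lie in boundedly enlarged copies of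
  finitely many caps whose volumes add up to the same order (\<open>economic_cap_covering\<close>).
\<^item> All triples whose cap lies in one enlarged cap have nearby \<open>w\<close>, hence separated differences
  \<open>b - a\<close>; their \<open>a, b\<close> lie in caps of \<open>K0, K1\<close>.  Translates of a cap of \<open>E\<close> by these differences
  are disjoint.  A convex set is up to a dimensional factor symmetric about a suitable point, so
  the difference of two caps is no larger than their sum, and the translates fill at most a multiple of the
  volume of one cap of \<open>C\<close> (\<open>card_disjoint_translates_le\<close>).
\<^item> A cap of \<open>E\<close> has size \<open>\<eta>\<^sup>2\<close> in the direction \<open>w\<close> and of order \<open>\<eta>\<close> in the other directions, so
  its volume is at least of order \<open>\<eta> ^ (d + 1)\<close> (\<open>measure_cylinder_cap_ge\<close>).

Dividing \<open>\<eta> ^ 3\<close> by \<open>\<eta> ^ (d + 1)\<close> gives the count.\<close>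

section \<open>Approximate centres of symmetry\<close>

text \<open>By Helly's theorem, the contracted copies of \<open>A\<close> with ratio \<open>d / (d + 1)\<close> and centres \<open>z \<in> A\<close>
have a common point, because any \<open>d + 1\<close> of them contain the centroid of their centres.  Such a
point \<open>g\<close> satisfies \<open>A - g \<subseteq> - d (A - g)\<close>.\<close>

lemma ex_central_point:
  fixes A :: "'a::euclidean_space set"
  assumes "compact A" "convex A" "A \<noteq> {}"
  obtains g where "g \<in> A" "\<And>z. z \<in> A \<Longrightarrow> g - (z - g) /\<^sub>R real DIM('a) \<in> A"
proof -
  define d where "d = real DIM('a)"
  have d: "d \<ge> 1" unfolding d_def by (simp add: Suc_leI)
  have inv: "1 + 1/d = (d + 1) / d" using d by (simp add: field_simps)
  define M where "M z = (\<lambda>x. (d / (d + 1)) *\<^sub>R x + z /\<^sub>R (d + 1)) ` A" for z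
  have M_iff: "g \<in> M z \<longleftrightarrow> g - (z - g) /\<^sub>R d \<in> A" for g z
  proof
    assume "g \<in> M z"
    then obtain x where x: "x \<in> A" "g = (d / (d + 1)) *\<^sub>R x + z /\<^sub>R (d + 1)" unfolding M_def by auto
    have "g - (z - g) /\<^sub>R d = (1 + 1/d) *\<^sub>R g - z /\<^sub>R d"
      by (simp add: algebra_simps divide_inverse)
    also have "\<dots> = ((1 + 1/d) * (d / (d + 1))) *\<^sub>R x + ((1 + 1/d) / (d + 1) - 1 / d) *\<^sub>R z"
      unfolding x(2) by (simp add: algebra_simps divide_inverse)
    also have "(1 + 1/d) * (d / (d + 1)) = 1" unfolding inv using d by simp
    also have "(1 + 1/d) / (d + 1) - 1 / d = 0" unfolding inv using d by simp
    finally show "g - (z - g) /\<^sub>R d \<in> A" using x by simp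
  next
    assume *: "g - (z - g) /\<^sub>R d \<in> A"
    have "(d / (d + 1)) *\<^sub>R (g - (z - g) /\<^sub>R d) + z /\<^sub>R (d + 1)
        = (d / (d + 1) * (1 + 1/d)) *\<^sub>R g + (1 / (d + 1) - d / (d + 1) / d) *\<^sub>R z"
      by (simp add: algebra_simps divide_inverse)
    also have "d / (d + 1) * (1 + 1/d) = 1" unfolding inv using d by simp
    also have "1 / (d + 1) - d / (d + 1) / d = 0" using d by simp
    finally have "g = (d / (d + 1)) *\<^sub>R (g - (z - g) /\<^sub>R d) + z /\<^sub>R (d + 1)" by simp
    then show "g \<in> M z" unfolding M_def using * by (rule image_eqI)
  qed
  have compM: "compact (M z)" for z
    unfolding M_def by (intro compact_continuous_image continuous_intros assms)
  have convM: "convex (M z)" for z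
  proof -
    have "M z = (\<lambda>x. z /\<^sub>R (d + 1) + x) ` ((*\<^sub>R) (d / (d + 1)) ` A)"
      unfolding M_def by (auto simp: image_image add.commute)
    then show ?thesis using convex_translation convex_scaling assms by metis
  qed
  have small: "\<Inter>T \<noteq> {}" if T: "T \<subseteq> M ` A" "finite T" "card T \<le> DIM('a) + 1" for T
  proof (cases "T = {}")
    case True then show ?thesis by simp
  next
    case False
    obtain Z where Z: "Z \<subseteq> A" "inj_on M Z" "T = M ` Z" using T(1) subset_image_inj by metis
    have fZ: "finite Z" and cZ: "card Z \<le> DIM('a) + 1"
      using T Z finite_imageD card_image by fastforce+
    obtain z0 where z0: "z0 \<in> Z" using Z(3) False by blast
    \<comment> \<open>Fewer than \<open>d + 1\<close> centres are treated as \<open>d + 1\<close> centres by counting \<open>z0\<close> repeatedly.\<close>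
    define a where "a z = (if z = z0 then d + 2 - card Z else 1)" for z
    have suma: "sum a Z = d + 1"
    proof -
      have "sum a Z = a z0 + sum a (Z - {z0})" using fZ z0 by (simp add: sum.remove)
      also have "sum a (Z - {z0}) = card (Z - {z0})" unfolding a_def by simp
      also have "real (card (Z - {z0})) = real (card Z) - 1"
        using card_Suc_Diff1[OF fZ z0] by linarith
      finally show ?thesis unfolding a_def by simp
    qed
    have a1: "a z \<ge> 1" for z unfolding a_def d_def using cZ by simp
    define p where "p = (\<Sum>z\<in>Z. a z *\<^sub>R z) /\<^sub>R (d + 1)"
    have "p \<in> M z" if z: "z \<in> Z" for z
    proof -
      have "p - (z - p) /\<^sub>R d = ((1 + 1/d) / (d + 1)) *\<^sub>R (\<Sum>z\<in>Z. a z *\<^sub>R z) - z /\<^sub>R d"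
        unfolding p_def by (simp add: algebra_simps divide_inverse)
      also have "(1 + 1/d) / (d + 1) = 1 / d" unfolding inv using d by simp
      also have "(1 / d) *\<^sub>R (\<Sum>z\<in>Z. a z *\<^sub>R z) - z /\<^sub>R d
          = (1 / d) *\<^sub>R (\<Sum>z\<in>Z. a z *\<^sub>R z) - (\<Sum>x\<in>Z. (if x = z then 1 else 0) *\<^sub>R x) /\<^sub>R d"
      proof -
        have "(\<Sum>x\<in>Z. (if x = z then 1 else 0) *\<^sub>R x) = z"
          using fZ z by (simp add: if_distrib[of "\<lambda>c. c *\<^sub>R _"] cong: if_cong)
        then show ?thesis by simp
      qed
      also have "\<dots> = (\<Sum>x\<in>Z. ((a x - (if x = z then 1 else 0)) / d) *\<^sub>R x)"
        unfolding scaleR_sum_right sum_subtractf[symmetric]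
        by (intro sum.cong refl) (simp add: algebra_simps divide_inverse)
      also have "\<dots> \<in> A"
      proof (rule convex_sum[OF fZ assms(2)])
        have "(\<Sum>i\<in>Z. (a i - (if i = z then 1 else 0)) / d) = (sum a Z - (\<Sum>i\<in>Z. (if i = z then 1 else 0))) / d"
          unfolding sum_divide_distrib[symmetric] sum_subtractf ..
        also have "\<dots> = 1" using suma fZ z d by simp
        finally show "(\<Sum>i\<in>Z. (a i - (if i = z then 1 else 0)) / d) = 1" .
        fix i assume i: "i \<in> Z"
        show "0 \<le> (a i - (if i = z then 1 else 0)) / d"
          using a1[of i] d by (intro divide_nonneg_nonneg) auto
        show "i \<in> A" using i Z by auto
      qed
      finally show ?thesis using M_iff by simp
    qed
    then show ?thesis using Z by auto
  qed
  have fin: "\<Inter>T \<noteq> {}" if T: "T \<subseteq> M ` A" "finite T" for T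
  proof (cases "card T \<ge> DIM('a) + 1")
    case True
    show ?thesis
    proof (rule Helly[OF True])
      show "\<forall>s\<in>T. convex s" using T convM by auto
      fix t assume "t \<subseteq> T" "card t = DIM('a) + 1"
      then show "\<Inter>t \<noteq> {}" using small[of t] T finite_subset[of t T] by auto
    qed
  qed (use small T in auto)
  have "\<Inter>(M ` A) \<noteq> {}"
    by (rule compact_fip_Heine_Borel) (use compM fin in auto)
  then obtain g where g: "\<And>z. z \<in> A \<Longrightarrow> g \<in> M z" by blast
  obtain z where z: "z \<in> A" using assms by auto
  have "g \<in> A"
  proof -
    define y where "y = g - (z - g) /\<^sub>R d"
    have "y \<in> A" using g[OF z] M_iff unfolding y_def by simp
    then have "(d / (d + 1)) *\<^sub>R y + (1 / (d + 1)) *\<^sub>R z \<in> A"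
      using d by (intro convexD[OF assms(2) _ z]) (auto simp: field_simps)
    also have "(d / (d + 1)) *\<^sub>R y + (1 / (d + 1)) *\<^sub>R z
        = (d / (d + 1) * (1 + 1/d)) *\<^sub>R g + (1 / (d + 1) - d / (d + 1) / d) *\<^sub>R z"
      unfolding y_def by (simp add: algebra_simps divide_inverse)
    also have "d / (d + 1) * (1 + 1/d) = 1" unfolding inv using d by simp
    also have "1 / (d + 1) - d / (d + 1) / d = 0" using d by simp
    finally show ?thesis by simp
  qed
  then show ?thesis using that g M_iff unfolding d_def by blast
qed

section \<open>Caps of a convex body\<close>

text \<open>The point \<open>c\<close> is meant to be a maximiser of \<open>w\<close> on \<open>C\<close>; then this is the cap of width \<open>t\<close> with
outward normal \<open>w\<close>.  Naming \<open>c\<close> avoids the support function.\<close>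

definition cap :: "'a::euclidean_space set \<Rightarrow> 'a \<Rightarrow> 'a \<Rightarrow> real \<Rightarrow> 'a set" where
  "cap C c w t = {x \<in> C. (c - x) \<bullet> w \<le> t}"

lemma cap_eq: "cap C c w t = C \<inter> {x. w \<bullet> x \<ge> c \<bullet> w - t}"
  unfolding cap_def by (auto simp: inner_diff_left inner_commute[of w])

lemma compact_cap: "compact C \<Longrightarrow> compact (cap C c w t)"
  unfolding cap_eq by (intro compact_Int_closed closed_halfspace_ge)

lemma convex_cap: "convex C \<Longrightarrow> convex (cap C c w t)"
  unfolding cap_eq by (intro convex_Int convex_halfspace_ge)

lemma exists_maximal_disjoint_subfamily:
  assumes "finite J"
  obtains I where "I \<subseteq> J" "disjoint_family_on Q I"
    "\<And>j. j \<in> J \<Longrightarrow> Q j \<noteq> {} \<Longrightarrow> \<exists>i\<in>I. Q j \<inter> Q i \<noteq> {}"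
proof -
  define \<I> where "\<I> = {I. I \<subseteq> J \<and> disjoint_family_on Q I}"
  have "finite \<I>" unfolding \<I>_def using assms by simp
  moreover have "{} \<in> \<I>" unfolding \<I>_def by (simp add: disjoint_family_on_def)
  ultimately obtain I where I: "I \<in> \<I>" "\<And>I'. I' \<in> \<I> \<Longrightarrow> I \<subseteq> I' \<Longrightarrow> I = I'"
    using finite_has_maximal[of \<I>] by blast
  have "\<exists>i\<in>I. Q j \<inter> Q i \<noteq> {}" if j: "j \<in> J" "Q j \<noteq> {}" for j
  proof (rule ccontr)
    assume no: "\<not> ?thesis"
    then have "insert j I \<in> \<I>" using I(1) j unfolding \<I>_def disjoint_family_on_def by blast
    then have "j \<in> I" using I(2) by blast
    then show False using no j by auto
  qed
  then show ?thesis using I that unfolding \<I>_def by blast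
qed

text \<open>Shrink every cap by half towards its approximate centre \<open>g\<close> and choose a maximal disjoint
family of these cores, which accounts for the sum of the volumes.  If the core of a cap meets the core of the \<open>i\<close>-th
chosen one, then \<open>g\<close> has depth at most \<open>2 \<delta>\<close> below the \<open>i\<close>-th supporting hyperplane.  The depth is affine and nonnegative on
\<open>C\<close>, and every point of the cap has an opposite point beyond \<open>g\<close> in \<open>C\<close>; hence the depth is at
most \<open>2 (d + 1) \<delta>\<close> on the whole cap.\<close>

lemma economic_cap_covering:
  fixes C :: "'a::euclidean_space set" and c w :: "'i \<Rightarrow> 'a" and \<delta> :: real
  assumes C: "compact C" "convex C" and "finite J" and "\<delta> \<ge> 0"
    and touch: "\<And>j. j \<in> J \<Longrightarrow> c j \<in> C" "\<And>j x. j \<in> J \<Longrightarrow> x \<in> C \<Longrightarrow> x \<bullet> w j \<le> c j \<bullet> w j"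
  obtains I where "I \<subseteq> J"
    "\<And>j. j \<in> J \<Longrightarrow> \<exists>i\<in>I. cap C (c j) (w j) \<delta> \<subseteq> cap C (c i) (w i) (2 * (real DIM('a) + 1) * \<delta>)"
    "(\<Sum>i\<in>I. measure lebesgue (cap C (c i) (w i) \<delta>))
      \<le> 2 ^ DIM('a) * measure lebesgue (\<Union>j\<in>J. cap C (c j) (w j) \<delta>)"
proof -
  define d where "d = real DIM('a)"
  have d: "d \<ge> 1" unfolding d_def by (simp add: Suc_leI)
  define A where "A j = cap C (c j) (w j) \<delta>" for j
  have cA: "compact (A j)" "convex (A j)" for j
    unfolding A_def using C compact_cap convex_cap by auto
  have neA: "A j \<noteq> {}" if "j \<in> J" for j
    using touch(1)[OF that] assms(4) unfolding A_def cap_def by auto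
  have "\<exists>g. g \<in> A j \<and> (\<forall>z\<in>A j. g - (z - g) /\<^sub>R d \<in> A j)" if "j \<in> J" for j
    using ex_central_point[OF cA neA[OF that]] unfolding d_def by metis
  then obtain g where g: "\<And>j. j \<in> J \<Longrightarrow> g j \<in> A j"
      "\<And>j z. j \<in> J \<Longrightarrow> z \<in> A j \<Longrightarrow> g j - (z - g j) /\<^sub>R d \<in> A j" by metis
  define Q where "Q j = (\<lambda>x. (1/2) *\<^sub>R x + (1/2) *\<^sub>R g j) ` A j" for j
  have QA: "Q j \<subseteq> A j" if "j \<in> J" for j
    unfolding Q_def using g(1)[OF that] cA(2)[of j]
    by (auto intro!: convexD)
  obtain I where I: "I \<subseteq> J" "disjoint_family_on Q I"
    "\<And>j. j \<in> J \<Longrightarrow> Q j \<noteq> {} \<Longrightarrow> \<exists>i\<in>I. Q j \<inter> Q i \<noteq> {}"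
    using exists_maximal_disjoint_subfamily[OF assms(3)] by metis
  have fI: "finite I" using I(1) assms(3) finite_subset by blast
  show ?thesis
  proof (rule that[OF I(1)])
    fix j assume j: "j \<in> J"
    have "Q j \<noteq> {}" unfolding Q_def using neA[OF j] by simp
    then obtain i m where i: "i \<in> I" "m \<in> Q j" "m \<in> Q i" using I(3)[OF j] by blast
    have iJ: "i \<in> J" using i I by auto
    define h where "h x = (c i - x) \<bullet> w i" for x
    have h0: "h x \<ge> 0" if "x \<in> C" for x
      unfolding h_def using touch(2)[OF iJ that] by (simp add: inner_diff_left)
    have AC: "A j \<subseteq> C" unfolding A_def cap_def by auto
    obtain z where z: "z \<in> A j" "m = (1/2) *\<^sub>R z + (1/2) *\<^sub>R g j" using i(2) unfolding Q_def by auto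
    have "h m \<le> \<delta>" using i(3) QA[OF iJ] unfolding A_def cap_def h_def by auto
    moreover have "2 * h m = h z + h (g j)" unfolding h_def z(2) by (simp add: inner_diff_left inner_add_left)
    ultimately have hg: "h (g j) \<le> 2 * \<delta>" using h0[of z] z AC by auto
    \<comment> \<open>The depth at the point opposite to \<open>y\<close> is nonnegative.\<close>
    have "h y \<le> 2 * (d + 1) * \<delta>" if y: "y \<in> A j" for y
    proof -
      have "0 \<le> h (g j - (y - g j) /\<^sub>R d)" using g(2)[OF j y] AC by (intro h0) auto
      also have "\<dots> = h (g j) - (h y - h (g j)) / d"
        unfolding h_def by (simp add: inner_diff_left divide_inverse algebra_simps)
      finally have "h y \<le> (d + 1) * h (g j)" using d by (simp add: field_simps)
      also have "\<dots> \<le> (d + 1) * (2 * \<delta>)" using hg d by (intro mult_left_mono) auto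
      finally show ?thesis by (simp add: mult_ac)
    qed
    then have "A j \<subseteq> cap C (c i) (w i) (2 * (d + 1) * \<delta>)"
      using AC unfolding h_def cap_def by blast
    then show "\<exists>i\<in>I. cap C (c j) (w j) \<delta> \<subseteq> cap C (c i) (w i) (2 * (real DIM('a) + 1) * \<delta>)"
      using i(1) unfolding A_def d_def by blast
  next
    have mQ: "measure lebesgue (Q j) = measure lebesgue (A j) / 2 ^ DIM('a)" for j
      unfolding Q_def measure_lebesgue_affine by (simp add: power_divide)
    have cQ: "compact (Q j)" for j
      unfolding Q_def by (intro compact_continuous_image continuous_intros cA)
    have "(\<Sum>i\<in>I. measure lebesgue (Q i)) = measure lebesgue (\<Union>i\<in>I. Q i)"
    proof (rule measure_finite_Union[symmetric, OF fI _ I(2)])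
      show "Q ` I \<subseteq> sets lebesgue" using cQ lmeasurable_compact by blast
      show "emeasure lebesgue (Q i) \<noteq> \<infinity>" for i
        using fmeasurableD2[OF lmeasurable_compact[OF cQ]] by simp
    qed
    also have "\<dots> \<le> measure lebesgue (\<Union>j\<in>J. A j)"
    proof (rule measure_mono_fmeasurable)
      show "(\<Union>i\<in>I. Q i) \<subseteq> (\<Union>j\<in>J. A j)" using QA I by blast
      show "(\<Union>i\<in>I. Q i) \<in> sets lebesgue"
        using cQ lmeasurable_compact fI by (intro fmeasurableD fmeasurable.finite_UN) auto
      show "(\<Union>j\<in>J. A j) \<in> lmeasurable"
        using cA lmeasurable_compact assms(3) by (intro fmeasurable.finite_UN) auto
    qed
    finally show "(\<Sum>i\<in>I. measure lebesgue (cap C (c i) (w i) \<delta>))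
      \<le> 2 ^ DIM('a) * measure lebesgue (\<Union>j\<in>J. cap C (c j) (w j) \<delta>)"
      unfolding mQ A_def[symmetric] by (simp add: sum_divide_distrib[symmetric] field_simps)
  qed
qed

text \<open>A point of depth at least 1 below all supporting hyperplanes in question serves as centre of a
homothety of ratio \<open>1 - 2 \<delta>\<close>: the image of \<open>C\<close> has depth at least \<open>2 \<delta>\<close> and so misses the caps.\<close>

lemma measure_caps_le:
  fixes C :: "'a::euclidean_space set" and c w :: "'i \<Rightarrow> 'a" and \<delta> :: real
  assumes C: "compact C" "convex C" and "finite J" and \<delta>: "0 < \<delta>" "\<delta> \<le> 1/2"
    and p: "p \<in> C" "\<And>j. j \<in> J \<Longrightarrow> (c j - p) \<bullet> w j \<ge> 1"
    and touch: "\<And>j x. j \<in> J \<Longrightarrow> x \<in> C \<Longrightarrow> x \<bullet> w j \<le> c j \<bullet> w j"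
  shows "measure lebesgue (\<Union>j\<in>J. cap C (c j) (w j) \<delta>) \<le> 2 * DIM('a) * \<delta> * measure lebesgue C"
proof -
  define s where "s = 2 * \<delta>"
  define C' where "C' = (\<lambda>x. (1 - s) *\<^sub>R x + s *\<^sub>R p) ` C"
  have s: "0 < s" "s \<le> 1" using \<delta> s_def by auto
  have C'C: "C' \<subseteq> C" unfolding C'_def using s p C by (auto intro!: convexD)
  have cC': "compact C'" unfolding C'_def by (intro compact_continuous_image continuous_intros C)
  have "measure lebesgue (\<Union>j\<in>J. cap C (c j) (w j) \<delta>) \<le> measure lebesgue (C - C')"
  proof (rule measure_mono_fmeasurable)
    show "(\<Union>j\<in>J. cap C (c j) (w j) \<delta>) \<in> sets lebesgue"
      using compact_cap[OF C(1)] lmeasurable_compact assms(3)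
      by (intro fmeasurableD fmeasurable.finite_UN) auto
    show "C - C' \<in> lmeasurable" using C cC' lmeasurable_compact by (intro fmeasurable.Diff) auto
    have "x \<notin> C'" if j: "j \<in> J" and x: "x \<in> cap C (c j) (w j) \<delta>" for j x
    proof
      assume "x \<in> C'"
      then obtain y where y: "y \<in> C" "x = (1 - s) *\<^sub>R y + s *\<^sub>R p" unfolding C'_def by auto
      have "(c j - x) \<bullet> w j = (1 - s) * ((c j - y) \<bullet> w j) + s * ((c j - p) \<bullet> w j)"
        unfolding y(2) by (simp add: inner_diff_left inner_add_left algebra_simps)
      also have "\<dots> \<ge> 0 + s * 1"
        using s p(2)[OF j] touch[OF j y(1)]
        by (intro add_mono mult_left_mono) (auto simp: inner_diff_left)
      finally have "(c j - x) \<bullet> w j \<ge> 2 * \<delta>" unfolding s_def by simp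
      then show False using x \<delta> unfolding cap_def by auto
    qed
    then show "(\<Union>j\<in>J. cap C (c j) (w j) \<delta>) \<subseteq> C - C'" unfolding cap_def by blast
  qed
  also have "\<dots> = measure lebesgue C - measure lebesgue C'"
    using C cC' C'C lmeasurable_compact by (intro measurable_measure_Diff) auto
  also have "\<dots> = (1 - (1 - s) ^ DIM('a)) * measure lebesgue C"
    unfolding C'_def measure_lebesgue_affine using s by (simp add: algebra_simps)
  also have "\<dots> \<le> (DIM('a) * s) * measure lebesgue C"
    using Bernoulli_inequality[of "-s" "DIM('a)"] s by (intro mult_right_mono) (auto simp: algebra_simps)
  finally show ?thesis unfolding s_def by (simp add: mult_ac)
qed

text \<open>Widening a cap by a factor \<open>t\<close> enlarges it at most by the homothety of ratio \<open>t\<close> centred at its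
touching point, since contracting towards that point stays in \<open>C\<close> and divides the depth by \<open>t\<close>.\<close>

lemma cap_subset_homothetic:
  assumes "convex C" "c \<in> C" "t \<ge> 1"
  shows "cap C c w (t * \<delta>) \<subseteq> (\<lambda>x. t *\<^sub>R x + (1 - t) *\<^sub>R c) ` cap C c w \<delta>"
proof
  fix x assume x: "x \<in> cap C c w (t * \<delta>)"
  define y where "y = (1/t) *\<^sub>R x + (1 - 1/t) *\<^sub>R c"
  have "y \<in> C" unfolding y_def using assms x by (intro convexD) (auto simp: cap_def)
  moreover have "(c - y) \<bullet> w = ((c - x) \<bullet> w) / t" unfolding y_def
    by (simp add: inner_diff_left inner_add_left algebra_simps diff_divide_distrib)
  then have "(c - y) \<bullet> w \<le> \<delta>" using x assms unfolding cap_def by (simp add: pos_divide_le_eq mult.commute)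
  moreover have "x = t *\<^sub>R y + (1 - t) *\<^sub>R c" unfolding y_def using assms(3)
    by (simp add: algebra_simps)
  ultimately show "x \<in> (\<lambda>x. t *\<^sub>R x + (1 - t) *\<^sub>R c) ` cap C c w \<delta>" unfolding cap_def by blast
qed

lemma measure_cap_mult_le:
  fixes C :: "'a::euclidean_space set"
  assumes "compact C" "convex C" "c \<in> C" "t \<ge> 1"
  shows "measure lebesgue (cap C c w (t * \<delta>)) \<le> t ^ DIM('a) * measure lebesgue (cap C c w \<delta>)"
proof -
  have "measure lebesgue (cap C c w (t * \<delta>)) \<le> measure lebesgue ((\<lambda>x. t *\<^sub>R x + (1 - t) *\<^sub>R c) ` cap C c w \<delta>)"
  proof (rule measure_mono_fmeasurable[OF cap_subset_homothetic[OF assms(2-4)]])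
    show "cap C c w (t * \<delta>) \<in> sets lebesgue"
      using compact_cap[OF assms(1)] lmeasurable_compact by blast
    show "(\<lambda>x. t *\<^sub>R x + (1 - t) *\<^sub>R c) ` cap C c w \<delta> \<in> lmeasurable"
      using compact_cap[OF assms(1)]
      by (intro lmeasurable_compact compact_continuous_image continuous_intros)
  qed
  then show ?thesis unfolding measure_lebesgue_affine using assms(4) by simp
qed

section \<open>Caps of a flat cylinder\<close>

text \<open>Adding the unit disc of the hyperplane orthogonal to \<open>e\<close> makes the normal \<open>w\<close> of a boundary point recoverable up to
\<open>O(\<eta>)\<close> from a cap of width \<open>\<eta>\<^sup>2\<close>.  The height \<open>\<eta>\<close> in the direction \<open>e\<close> keeps the bodies
full-dimensional at a cost in volume that matches the scale of separation.\<close>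

definition cylinder :: "'a::euclidean_space \<Rightarrow> real \<Rightarrow> 'a set" where
  "cylinder e \<eta> = {x. \<bar>x \<bullet> e\<bar> \<le> \<eta> \<and> norm (x - (x \<bullet> e) *\<^sub>R e) \<le> 1}"

lemma convex_cylinder: "convex (cylinder e \<eta>)"
proof -
  have "cylinder e \<eta> = ({x. e \<bullet> x \<le> \<eta>} \<inter> {x. e \<bullet> x \<ge> - \<eta>})
      \<inter> (\<lambda>x. x - (x \<bullet> e) *\<^sub>R e) -` cball 0 1"
    unfolding cylinder_def by (auto simp: inner_commute abs_le_iff)
  moreover have "linear (\<lambda>x. x - (x \<bullet> e) *\<^sub>R e)"
    by (auto intro!: linearI simp: inner_add_left algebra_simps)
  ultimately show ?thesis
    by (auto intro!: convex_Int convex_halfspace_ge convex_halfspace_le convex_linear_vimage)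
qed

lemma norm_cylinder_le:
  assumes "norm e = 1" "x \<in> cylinder e \<eta>"
  shows "norm x \<le> 1 + \<eta>"
proof -
  have "norm x \<le> norm (x - (x \<bullet> e) *\<^sub>R e) + norm ((x \<bullet> e) *\<^sub>R e)"
    using norm_triangle_ineq[of "x - (x \<bullet> e) *\<^sub>R e" "(x \<bullet> e) *\<^sub>R e"] by simp
  then show ?thesis using assms unfolding cylinder_def by simp
qed

lemma compact_cylinder:
  assumes "norm e = 1"
  shows "compact (cylinder e \<eta>)"
proof -
  have "closed (cylinder e \<eta>)" unfolding cylinder_def
    by (intro closed_Collect_conj closed_Collect_le continuous_intros)
  moreover have "bounded (cylinder e \<eta>)"
    using norm_cylinder_le[OF assms] by (auto simp: bounded_iff)
  ultimately show ?thesis by (simp add: compact_eq_bounded_closed)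
qed

lemma inner_cylinder_le:
  assumes "x \<in> cylinder e \<eta>" "norm w = 1" "w \<bullet> e = 0"
  shows "x \<bullet> w \<le> 1"
proof -
  have "x \<bullet> w = (x - (x \<bullet> e) *\<^sub>R e) \<bullet> w"
    using assms inner_commute[of e w] by (simp add: inner_diff_left)
  also have "\<dots> \<le> norm (x - (x \<bullet> e) *\<^sub>R e) * norm w" by (rule norm_cauchy_schwarz)
  finally show ?thesis using assms unfolding cylinder_def by simp
qed

lemma mem_cylinder_orthogonal:
  assumes "norm w = 1" "w \<bullet> e = 0" "\<eta> \<ge> 0"
  shows "w \<in> cylinder e \<eta>"
  using assms unfolding cylinder_def by simp

lemma norm_diff_cylinder_cap_le:
  assumes "norm e = 1" "norm w = 1" "w \<bullet> e = 0" "x \<in> cap (cylinder e \<eta>) w w t"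
  shows "norm (x - w) \<le> sqrt (2 * t) + \<eta>"
proof -
  define y where "y = x - (x \<bullet> e) *\<^sub>R e"
  have x: "\<bar>x \<bullet> e\<bar> \<le> \<eta>" "norm y \<le> 1" "(w - x) \<bullet> w \<le> t"
    using assms unfolding cap_def cylinder_def y_def by auto
  have ww: "w \<bullet> w = 1" using assms by (simp add: norm_eq_1)
  have "y \<bullet> w = x \<bullet> w" unfolding y_def using assms inner_commute[of e w] by (simp add: inner_diff_left)
  moreover have "(norm y)\<^sup>2 \<le> 1" using x(2) by (simp add: power_le_one)
  ultimately have "(norm (y - w))\<^sup>2 \<le> 2 * t"
    using x(3) ww by (simp add: power2_norm_eq_inner inner_diff_left inner_diff_right inner_commute)
  then have "norm (y - w) \<le> sqrt (2 * t)" by (rule real_le_rsqrt)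
  moreover have "norm (x - w) \<le> norm (y - w) + norm ((x \<bullet> e) *\<^sub>R e)"
    using norm_triangle_ineq[of "y - w" "(x \<bullet> e) *\<^sub>R e"] unfolding y_def by simp
  ultimately show ?thesis using x(1) assms(1) by simp
qed

text \<open>The ball of radius \<open>\<eta>/4\<close> is covered by \<open>O(1/\<eta>)\<close> translates of the cap along \<open>w\<close>, because the
cap contains a plate of thickness \<open>\<eta>\<^sup>2/2\<close> across \<open>w\<close> whose extent in the orthogonal
directions is at least \<open>\<eta>/4\<close>.\<close>

lemma measure_cylinder_cap_ge:
  fixes e w :: "'a::euclidean_space"
  assumes e: "norm e = 1" and w: "norm w = 1" "w \<bullet> e = 0" and \<eta>: "0 < \<eta>" "\<eta> \<le> 1/2"
  shows "unit_ball_vol DIM('a) / (3 * 4 ^ DIM('a)) * \<eta> ^ (DIM('a) + 1)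
    \<le> measure lebesgue (cap (cylinder e \<eta>) w w (\<eta>\<^sup>2))"
proof -
  define G where "G = cap (cylinder e \<eta>) w w (\<eta>\<^sup>2)"
  define \<sigma> where "\<sigma> = \<eta>\<^sup>2 / 2"
  define M where "M = \<lfloor>1 / (2 * \<eta>) + 1\<rfloor>"
  have \<sigma>: "\<sigma> > 0" unfolding \<sigma>_def using \<eta> by simp
  have cG: "compact G" unfolding G_def by (intro compact_cap compact_cylinder e)
  \<comment> \<open>The factor 1 brings the translation into the form of the scaling law for Lebesgue measure.\<close>
  define f where "f k x = 1 *\<^sub>R x + (of_int k * \<sigma> - (1 - \<eta>\<^sup>2)) *\<^sub>R w" for k :: int and x
  have cover: "cball 0 (\<eta>/4) \<subseteq> (\<Union>k\<in>{-M..M}. f k ` G)"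
  proof
    fix y :: 'a assume "y \<in> cball 0 (\<eta>/4)"
    then have ny: "norm y \<le> \<eta>/4" by simp
    have ww: "w \<bullet> w = 1" and ee: "e \<bullet> e = 1" using w e by (simp_all add: norm_eq_1)
    have ye: "\<bar>y \<bullet> e\<bar> \<le> \<eta>/4" and yw: "\<bar>y \<bullet> w\<bar> \<le> \<eta>/4"
      using Cauchy_Schwarz_ineq2[of y e] Cauchy_Schwarz_ineq2[of y w] e w ny by simp_all
    \<comment> \<open>Subtracting a multiple of \<open>\<sigma> w\<close> brings the height of \<open>y\<close> along \<open>w\<close> into \<open>[0, \<sigma>]\<close>.\<close>
    define k where "k = \<lfloor>(y \<bullet> w) / \<sigma>\<rfloor>"
    define r where "r = y \<bullet> w - of_int k * \<sigma>"
    have r: "0 \<le> r" "r \<le> \<sigma>"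
    proof -
      have "of_int k \<le> (y \<bullet> w) / \<sigma>" "(y \<bullet> w) / \<sigma> \<le> of_int k + 1"
        unfolding k_def by linarith+
      then show "0 \<le> r" "r \<le> \<sigma>" unfolding r_def using \<sigma> by (auto simp: field_simps)
    qed
    have "\<bar>(y \<bullet> w) / \<sigma>\<bar> \<le> (\<eta>/4) / \<sigma>" using yw \<sigma> divide_right_mono[OF yw, of \<sigma>] by simp
    also have "(\<eta>/4) / \<sigma> = 1 / (2 * \<eta>)" unfolding \<sigma>_def using \<eta> by (simp add: field_simps power2_eq_square)
    finally have "k \<le> M \<and> - M \<le> k" unfolding k_def M_def by linarith
    then have kM: "k \<in> {-M..M}" by auto
    define x where "x = y - (of_int k * \<sigma> - (1 - \<eta>\<^sup>2)) *\<^sub>R w"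
    define z where "z = y - (y \<bullet> e) *\<^sub>R e - (y \<bullet> w) *\<^sub>R w"
    have we: "w \<bullet> e = 0" "e \<bullet> w = 0" using w by (simp_all add: inner_commute)
    have xe: "x \<bullet> e = y \<bullet> e" unfolding x_def using w by (simp add: inner_diff_left)
    have xw: "x \<bullet> w = r + 1 - \<eta>\<^sup>2" unfolding x_def r_def using ww by (simp add: inner_diff_left)
    have zw: "z \<bullet> w = 0" "z \<bullet> e = 0" unfolding z_def using we ww ee by (simp_all add: inner_diff_left)
    have Px: "x - (x \<bullet> e) *\<^sub>R e = z + (r + 1 - \<eta>\<^sup>2) *\<^sub>R w"
      unfolding xe unfolding x_def z_def r_def by (simp add: algebra_simps)
    have "y = z + (y \<bullet> e) *\<^sub>R e + (y \<bullet> w) *\<^sub>R w" unfolding z_def by simp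
    then have "y \<bullet> y = (z + (y \<bullet> e) *\<^sub>R e + (y \<bullet> w) *\<^sub>R w) \<bullet> (z + (y \<bullet> e) *\<^sub>R e + (y \<bullet> w) *\<^sub>R w)" by simp
    also have "\<dots> = z \<bullet> z + (y \<bullet> e)\<^sup>2 + (y \<bullet> w)\<^sup>2"
      using zw we ww ee by (simp add: inner_add_left inner_add_right inner_commute[of w z] inner_commute[of e z] power2_eq_square)
    finally have "z \<bullet> z \<le> y \<bullet> y" by simp
    also have "\<dots> \<le> (\<eta>/4)\<^sup>2" using ny by (simp add: power2_norm_eq_inner[symmetric] power_mono)
    finally have zz: "z \<bullet> z \<le> \<eta>\<^sup>2 / 16" by (simp add: power_divide)
    have \<eta>2: "\<eta>\<^sup>2 \<le> 1/4" "\<eta>\<^sup>2 > 0" using \<eta> power_mono[of \<eta> "1/2" 2] by (simp_all add: power_divide)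
    have Px2: "(norm (x - (x \<bullet> e) *\<^sub>R e))\<^sup>2 = z \<bullet> z + (r + 1 - \<eta>\<^sup>2)\<^sup>2"
      unfolding Px power2_norm_eq_inner using zw ww
      by (simp add: inner_add_left inner_add_right inner_commute[of w z] power2_eq_square)
    have "(r + 1 - \<eta>\<^sup>2)\<^sup>2 \<le> (1 - \<eta>\<^sup>2 / 2)\<^sup>2"
      using r \<eta>2 unfolding \<sigma>_def by (intro power_mono) auto
    also have "(1 - \<eta>\<^sup>2 / 2)\<^sup>2 = 1 - \<eta>\<^sup>2 + \<eta>\<^sup>2 * \<eta>\<^sup>2 / 4"
      by (simp add: power2_eq_square algebra_simps)
    finally have "(r + 1 - \<eta>\<^sup>2)\<^sup>2 \<le> 1 - \<eta>\<^sup>2 + \<eta>\<^sup>2 * \<eta>\<^sup>2 / 4" .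
    moreover have "\<eta>\<^sup>2 * \<eta>\<^sup>2 \<le> (1/4) * \<eta>\<^sup>2" using \<eta>2 by (intro mult_right_mono) auto
    ultimately have "(norm (x - (x \<bullet> e) *\<^sub>R e))\<^sup>2 \<le> 1" unfolding Px2 using zz \<eta>2 by linarith
    then have "(norm (x - (x \<bullet> e) *\<^sub>R e))\<^sup>2 \<le> 1\<^sup>2" by simp
    then have "norm (x - (x \<bullet> e) *\<^sub>R e) \<le> 1" by (rule power2_le_imp_le) simp
    then have "x \<in> G" unfolding G_def cap_def cylinder_def using xe ye xw r ww \<eta>
      by (simp add: inner_diff_left)
    moreover have "y = f k x" unfolding f_def x_def by simp
    ultimately show "y \<in> (\<Union>k\<in>{-M..M}. f k ` G)" using kM by blast
  qed
  have cf: "compact (f k ` G)" for k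
    unfolding f_def by (intro compact_continuous_image continuous_intros cG)
  have "unit_ball_vol DIM('a) * (\<eta>/4) ^ DIM('a) = measure lebesgue (cball 0 (\<eta>/4) :: 'a set)"
    using \<eta> by (simp add: content_cball)
  also have "\<dots> \<le> measure lebesgue (\<Union>k\<in>{-M..M}. f k ` G)"
    by (rule measure_mono_fmeasurable[OF cover])
       (use cf in \<open>auto intro!: fmeasurable.finite_UN lmeasurable_compact\<close>)
  also have "\<dots> \<le> (\<Sum>k\<in>{-M..M}. measure lebesgue (f k ` G))"
    by (rule measure_UNION_le) (use cf lmeasurable_compact in \<open>auto intro: fmeasurableD\<close>)
  also have "\<dots> = real (card {-M..M}) * measure lebesgue G"
    unfolding f_def measure_lebesgue_affine by simp
  also have "\<dots> \<le> (3 / \<eta>) * measure lebesgue G"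
  proof (rule mult_right_mono)
    have "M \<ge> 0" unfolding M_def using \<eta> by simp
    then have "real (card {-M..M}) = 2 * of_int M + 1" by simp
    also have "\<dots> \<le> 1 / \<eta> + 3" 
    proof -
      have "2 * of_int M \<le> 2 * (1 / (2 * \<eta>) + 1)"
        unfolding M_def by (intro mult_left_mono of_int_floor_le) simp
      also have "\<dots> = 1 / \<eta> + 2" using \<eta> by (simp add: field_simps)
      finally show ?thesis by simp
    qed
    also have "\<dots> \<le> 3 / \<eta>" using \<eta> by (simp add: field_simps)
    finally show "real (card {-M..M}) \<le> 3 / \<eta>" .
  qed simp
  finally show ?thesis unfolding G_def using \<eta> by (simp add: field_simps power_divide)
qed

lemma measure_slab_le:
  fixes C :: "'a::euclidean_space set"
  assumes "compact C" and e: "e \<in> Basis" and "R \<ge> 0" "\<eta> \<ge> 0"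
    and "\<And>x. x \<in> C \<Longrightarrow> norm x \<le> R \<and> \<bar>x \<bullet> e - q\<bar> \<le> \<eta>"
  shows "measure lebesgue C \<le> 2 * \<eta> * (2 * R) ^ (DIM('a) - 1)"
proof -
  define l u where "l = (\<Sum>b\<in>Basis. (if b = e then q - \<eta> else - R) *\<^sub>R b)"
    and "u = (\<Sum>b\<in>Basis. (if b = e then q + \<eta> else R) *\<^sub>R (b::'a))"
  have li: "l \<bullet> b = (if b = e then q - \<eta> else - R)" "u \<bullet> b = (if b = e then q + \<eta> else R)"
    if "b \<in> Basis" for b
    unfolding l_def u_def using that by simp_all
  have "C \<subseteq> cbox l u"
  proof
    fix x assume x: "x \<in> C"
    show "x \<in> cbox l u" unfolding mem_box
    proof
      fix b :: 'a assume b: "b \<in> Basis"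
      have "\<bar>x \<bullet> b\<bar> \<le> R" using Basis_le_norm[OF b, of x] assms(5)[OF x] by simp
      then show "l \<bullet> b \<le> x \<bullet> b \<and> x \<bullet> b \<le> u \<bullet> b" using assms(5)[OF x] b li by auto
    qed
  qed
  then have "measure lebesgue C \<le> measure lebesgue (cbox l u)"
    by (rule measure_mono_fmeasurable) (use assms(1) in \<open>auto intro: fmeasurableD lmeasurable_compact\<close>)
  also have "\<dots> = (\<Prod>b\<in>Basis. u \<bullet> b - l \<bullet> b)"
  proof -
    have "\<forall>b\<in>Basis. l \<bullet> b \<le> u \<bullet> b" using li assms by auto
    then show ?thesis by (simp add: content_cbox inner_diff_left)
  qed
  also have "\<dots> = (\<Prod>b\<in>Basis. if b = e then 2 * \<eta> else 2 * R)"
    by (intro prod.cong) (auto simp: li)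
  also have "\<dots> = 2 * \<eta> * (2 * R) ^ (DIM('a) - 1)"
    using e by (subst prod.remove[OF _ e]) (auto simp: card_Diff_singleton)
  finally show ?thesis .
qed

section \<open>Minkowski content from separated sets\<close>

text \<open>A separated set of maximal cardinality is a net, and the parallel set is covered by balls
of comparable radius around it.\<close>

lemma finite_minkowski_content_if_separated_sets_bounded:
  fixes S :: "'a::euclidean_space set" and m B D r :: real
  assumes "D > 0" "r > 0"
    and bound: "\<And>\<epsilon> F. \<lbrakk>0 < \<epsilon>; \<epsilon> < r; finite F; F \<subseteq> S; pairwise (\<lambda>x y. dist x y > D * \<epsilon>) F\<rbrakk>
      \<Longrightarrow> real (card F) * \<epsilon> powr m \<le> B"
  shows "finite_minkowski_content m S"
proof -
  define n where "n = DIM('a)"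
  define V where "V = unit_ball_vol n * (D + 2) ^ n * 2 powr (m - n)"
  have V0: "V \<ge> 0" unfolding V_def using assms by simp
  have main: "ennreal ((2 * \<epsilon>) powr (m - n)) * emeasure lebesgue (parallel_set S \<epsilon>) \<le> ennreal (B * V)"
    if \<epsilon>: "0 < \<epsilon>" "\<epsilon> < r" for \<epsilon>
  proof -
    define \<F> where "\<F> F \<longleftrightarrow> finite F \<and> F \<subseteq> S \<and> pairwise (\<lambda>x y. dist x y > D * \<epsilon>) F" for F
    have "\<F> {}" unfolding \<F>_def by simp
    moreover have "card F \<le> nat \<lfloor>B / \<epsilon> powr m\<rfloor>" if "\<F> F" for F
    proof -
      have "real (card F) \<le> B / \<epsilon> powr m"
        using bound[OF \<epsilon>, of F] that \<epsilon> unfolding \<F>_def by (simp add: field_simps)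
      then show ?thesis by linarith
    qed
    ultimately obtain F where F: "\<F> F" "\<And>F'. \<F> F' \<Longrightarrow> card F' \<le> card F"
      using ex_has_greatest_nat[of \<F> "{}" card "Suc (nat \<lfloor>B / \<epsilon> powr m\<rfloor>)"] by (metis le_imp_less_Suc order_less_imp_le)
    have fF: "finite F" using F unfolding \<F>_def by simp
    have cover: "\<exists>x\<in>F. dist x y \<le> D * \<epsilon>" if y: "y \<in> S" for y
    proof (rule ccontr)
      assume no: "\<not> ?thesis"
      then have "y \<notin> F" using \<epsilon> assms(1) by force
      moreover have "\<F> (insert y F)" using F(1) no y unfolding \<F>_def
        by (auto simp: pairwise_insert dist_commute not_le)
      ultimately show False using F(2)[of "insert y F"] fF by simp
    qed
    have sub: "parallel_set S \<epsilon> \<subseteq> (\<Union>x\<in>F. cball x ((D + 2) * \<epsilon>))"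
    proof
      fix y assume "y \<in> parallel_set S \<epsilon>"
      then have y: "S \<noteq> {}" "infdist y S < 2 * \<epsilon>" using \<epsilon> unfolding parallel_set_def by auto
      then obtain s where s: "s \<in> S" "dist y s < 2 * \<epsilon>"
        using infdist_notempty[of S y] cINF_less_iff[of S "dist y" "2 * \<epsilon>"] by auto
      obtain x where x: "x \<in> F" "dist x s \<le> D * \<epsilon>" using cover[OF s(1)] by blast
      have "dist x y \<le> (D + 2) * \<epsilon>" using dist_triangle2[of x y s] s x by (simp add: algebra_simps)
      then show "y \<in> (\<Union>x\<in>F. cball x ((D + 2) * \<epsilon>))" using x by auto
    qed
    have D2: "(D + 2) * \<epsilon> \<ge> 0" using assms \<epsilon> by simp
    have "emeasure lebesgue (parallel_set S \<epsilon>) \<le> emeasure lebesgue (\<Union>x\<in>F. cball x ((D + 2) * \<epsilon>))"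
      by (rule emeasure_mono[OF sub]) (use fF in auto)
    also have "\<dots> \<le> (\<Sum>x\<in>F. emeasure lebesgue (cball x ((D + 2) * \<epsilon>)))"
      by (rule emeasure_subadditive_finite) (use fF in auto)
    also have "\<dots> = (\<Sum>x\<in>F. ennreal (unit_ball_vol n * ((D + 2) * \<epsilon>) ^ n))"
      using emeasure_cball[OF D2, where 'a='a] unfolding n_def by simp
    also have "\<dots> = ennreal (card F * (unit_ball_vol n * ((D + 2) * \<epsilon>) ^ n))"
      using D2 by (simp add: ennreal_mult ennreal_of_nat_eq_real_of_nat)
    finally have "ennreal ((2 * \<epsilon>) powr (m - n)) * emeasure lebesgue (parallel_set S \<epsilon>)
       \<le> ennreal ((2 * \<epsilon>) powr (m - n)) * ennreal (card F * (unit_ball_vol n * ((D + 2) * \<epsilon>) ^ n))"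
      by (rule mult_left_mono) simp
    also have "\<dots> = ennreal ((2 * \<epsilon>) powr (m - n) * (card F * (unit_ball_vol n * ((D + 2) * \<epsilon>) ^ n)))"
      by (rule ennreal_mult'[symmetric]) simp
    also have "(2 * \<epsilon>) powr (m - n) * (card F * (unit_ball_vol n * ((D + 2) * \<epsilon>) ^ n))
       = (card F * \<epsilon> powr m) * V"
    proof -
      have "(2 * \<epsilon>) powr (m - n) = 2 powr (m - n) * (\<epsilon> powr m / \<epsilon> ^ n)"
        using \<epsilon> by (simp add: powr_mult powr_diff powr_realpow)
      then show ?thesis unfolding V_def using \<epsilon> by (simp add: power_mult_distrib)
    qed
    also have "\<dots> \<le> B * V"
      using bound[OF \<epsilon>, of F] F(1) V0 unfolding \<F>_def by (intro mult_right_mono) auto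
    finally show ?thesis by (simp add: ennreal_leI)
  qed
  have "eventually (\<lambda>\<epsilon>. ennreal ((2 * \<epsilon>) powr (m - n)) * emeasure lebesgue (parallel_set S \<epsilon>) \<le> ennreal (B * V)) (at_right 0)"
    using main eventually_at_right_less[of 0] assms(2) 
    by (intro eventually_at_rightI[of 0 r]) auto
  then have "upper_minkowski_content m S \<le> ennreal (B * V)"
    unfolding upper_minkowski_content_def n_def by (rule Limsup_bounded)
  then show ?thesis unfolding finite_minkowski_content_def
    using ennreal_less_top le_less_trans by (metis infinity_ennreal_def)
qed

section \<open>Counting separated differences of touching points\<close>

text \<open>Differences are turned into sums by the approximate centre \<open>g\<close> of \<open>A\<close>: every \<open>- a\<close> equals
\<open>d x\<close> for some \<open>x \<in> A\<close>, up to a constant vector depending on \<open>g\<close> alone.  Contracting \<open>B\<close> and \<open>G\<close> by \<open>1/d\<close> towards fixed points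
shows that all translates lie in one copy of \<open>X\<close> scaled by \<open>d\<close>.\<close>

lemma card_disjoint_translates_le:
  fixes A B G X :: "'a::euclidean_space set" and a b :: "'i \<Rightarrow> 'a"
  assumes A: "compact A" "convex A" and B: "convex B" and G: "compact G" "convex G" "G \<noteq> {}"
    and X: "compact X" "\<And>x y z. x \<in> A \<Longrightarrow> y \<in> B \<Longrightarrow> z \<in> G \<Longrightarrow> x + y + z \<in> X"
    and J: "finite J" "\<And>j. j \<in> J \<Longrightarrow> a j \<in> A" "\<And>j. j \<in> J \<Longrightarrow> b j \<in> B"
    and disj: "disjoint_family_on (\<lambda>j. (+) (b j - a j) ` G) J"
  shows "real (card J) * measure lebesgue G \<le> real DIM('a) ^ DIM('a) * measure lebesgue X"
proof (cases "J = {}")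
  case True
  then show ?thesis by simp
next
  case False
  define d where "d = real DIM('a)"
  have d: "d \<ge> 1" unfolding d_def by (simp add: Suc_leI)
  obtain j0 where j0: "j0 \<in> J" using False by auto
  obtain g where g: "g \<in> A" "\<And>z. z \<in> A \<Longrightarrow> g - (z - g) /\<^sub>R d \<in> A"
    using ex_central_point[OF A] J(2)[OF j0] unfolding d_def by blast
  obtain z0 where z0: "z0 \<in> G" using G by auto
  define \<tau> where "\<tau> = (d - 1) *\<^sub>R b j0 + (d - 1) *\<^sub>R z0 + (d + 1) *\<^sub>R g"
  define f where "f x = d *\<^sub>R x + (- \<tau>)" for x
  have contract: "y0 + (1/d) *\<^sub>R (y - y0) \<in> S" if "convex S" "y0 \<in> S" "y \<in> S" for S and y0 y :: 'a
  proof -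
    have "(1 - 1/d) *\<^sub>R y0 + (1/d) *\<^sub>R y \<in> S" using that d by (intro convexD) auto
    then show ?thesis by (simp add: algebra_simps)
  qed
  have sub: "(\<Union>j\<in>J. (+) (b j - a j) ` G) \<subseteq> f ` X"
  proof clarify
    fix j z assume j: "j \<in> J" and z: "z \<in> G"
    define p where "p = (g - (a j - g) /\<^sub>R d) + (b j0 + (1/d) *\<^sub>R (b j - b j0)) + (z0 + (1/d) *\<^sub>R (z - z0))"
    have "p \<in> X" unfolding p_def
      using g(2)[OF J(2)[OF j]] contract[OF B J(3)[OF j0] J(3)[OF j]] contract[OF G(2) z0 z]
      by (rule X(2))
    moreover have "f p = b j - a j + z"
      unfolding f_def p_def \<tau>_def using d by (simp add: algebra_simps)
    ultimately show "b j - a j + z \<in> f ` X" by (metis image_eqI)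
  qed
  have cT: "compact ((+) v ` G)" for v by (intro compact_continuous_image continuous_intros G)
  have "real (card J) * measure lebesgue G = (\<Sum>j\<in>J. measure lebesgue ((+) (b j - a j) ` G))"
    by (simp add: measure_translation)
  also have "\<dots> = measure lebesgue (\<Union>j\<in>J. (+) (b j - a j) ` G)"
  proof (rule measure_finite_Union[symmetric, OF J(1) _ disj])
    show "(\<lambda>j. (+) (b j - a j) ` G) ` J \<subseteq> sets lebesgue" using cT lmeasurable_compact by blast
    show "emeasure lebesgue ((+) (b i - a i) ` G) \<noteq> \<infinity>" for i
      using fmeasurableD2[OF lmeasurable_compact[OF cT]] by simp
  qed
  also have "\<dots> \<le> measure lebesgue (f ` X)"
  proof (rule measure_mono_fmeasurable[OF sub])
    show "(\<Union>j\<in>J. (+) (b j - a j) ` G) \<in> sets lebesgue"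
      using cT lmeasurable_compact J(1) by (intro fmeasurableD fmeasurable.finite_UN) auto
    show "f ` X \<in> lmeasurable" unfolding f_def
      by (intro lmeasurable_compact compact_continuous_image continuous_intros X)
  qed
  finally show ?thesis unfolding f_def measure_lebesgue_affine d_def by simp
qed

text \<open>Here \<open>\<kappa>\<close> is the widening factor of \<open>economic_cap_covering\<close>, and \<open>(sqrt (2 \<kappa>) + 1) \<eta>\<close> bounds
the distance from \<open>w\<close> in a cap of the cylinder of width \<open>\<kappa> \<eta>\<^sup>2\<close>; pairs that are separated by twice
this radius either are assigned to different caps or give disjoint translates of such a cap.\<close>

lemma card_separated_touching_pairs_le:
  fixes K0 K1 :: "'a::euclidean_space set" and a b w :: "'i \<Rightarrow> 'a"
  defines "\<kappa> \<equiv> 2 * (real DIM('a) + 1)"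
  assumes e: "e \<in> Basis" and R: "R \<ge> 0"
    and K0: "compact K0" "convex K0" "\<And>x. x \<in> K0 \<Longrightarrow> norm x \<le> R \<and> x \<bullet> e = q0"
    and K1: "compact K1" "convex K1" "\<And>x. x \<in> K1 \<Longrightarrow> norm x \<le> R \<and> x \<bullet> e = q1"
    and \<eta>: "0 < \<eta>" "\<eta> \<le> 1/2" and J: "finite J"
    and w: "\<And>j. j \<in> J \<Longrightarrow> norm (w j) = 1 \<and> w j \<bullet> e = 0"
    and a: "\<And>j. j \<in> J \<Longrightarrow> a j \<in> K0" "\<And>j x. j \<in> J \<Longrightarrow> x \<in> K0 \<Longrightarrow> x \<bullet> w j \<le> a j \<bullet> w j"
    and b: "\<And>j. j \<in> J \<Longrightarrow> b j \<in> K1" "\<And>j x. j \<in> J \<Longrightarrow> x \<in> K1 \<Longrightarrow> x \<bullet> w j \<le> b j \<bullet> w j"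
    and sep: "\<And>i j. \<lbrakk>i \<in> J; j \<in> J; i \<noteq> j; norm (w i - w j) \<le> 2 * (sqrt (2 * \<kappa>) + 1) * \<eta>\<rbrakk>
      \<Longrightarrow> norm ((b i - a i) - (b j - a j)) > 2 * (sqrt (2 * \<kappa>) + 1) * \<eta>"
  shows "real (card J) * (unit_ball_vol DIM('a) / (3 * 4 ^ DIM('a)) * \<eta> ^ (DIM('a) + 1))
    \<le> (6 * \<kappa> * DIM('a)) ^ DIM('a) * 4 * DIM('a) * (4 * R + 4) ^ (DIM('a) - 1) * \<eta> ^ 3"
proof (cases "J = {}")
  case True
  then show ?thesis using \<eta> R by (simp add: \<kappa>_def)
next
  case False
  define d where "d = DIM('a)"
  define \<delta> where "\<delta> = \<eta>\<^sup>2"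
  define \<rho> where "\<rho> = (sqrt (2 * \<kappa>) + 1) * \<eta>"
  define E where "E = cylinder e \<eta>"
  define C where "C = {x + u |x u. x \<in> K0 \<and> u \<in> {y + z |y z. y \<in> K1 \<and> z \<in> E}}"
  have d: "d \<ge> 1" unfolding d_def by (simp add: Suc_leI)
  have \<kappa>: "\<kappa> \<ge> 1" unfolding \<kappa>_def by simp
  have \<delta>: "0 < \<delta>" "\<delta> \<le> 1/2" "\<delta> \<le> \<kappa> * \<delta>"
    using \<eta> power_mono[of \<eta> "1/2" 2] \<kappa> unfolding \<delta>_def by (simp_all add: power_divide)
  have e1: "norm e = 1" using e by simp
  have cE: "compact E" "convex E" unfolding E_def using compact_cylinder[OF e1] convex_cylinder by auto
  have cC: "compact C" unfolding C_def by (intro compact_sums K0 K1 cE)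
  have "C = (\<Union>x\<in>K0. \<Union>u\<in>(\<Union>y\<in>K1. \<Union>z\<in>E. {y + z}). {x + u})" unfolding C_def by auto
  then have "convex C" by (simp only: convex_sums K0 K1 cE)
  note cC = cC this
  have CI: "x + y + z \<in> C" if "x \<in> K0" "y \<in> K1" "z \<in> E" for x y z
    unfolding C_def using that by (force simp: add.assoc)
  have CE: "\<exists>x\<in>K0. \<exists>y\<in>K1. \<exists>z\<in>E. v = x + y + z" if "v \<in> C" for v
    using that unfolding C_def by (force simp: add.assoc)
  define c where "c j = a j + b j + w j" for j
  have wE: "w j \<in> E" "\<And>x. x \<in> E \<Longrightarrow> x \<bullet> w j \<le> 1" "w j \<bullet> w j = 1" if "j \<in> J" for j
    using w[OF that] mem_cylinder_orthogonal[of "w j" e \<eta>] inner_cylinder_le[of _ e \<eta> "w j"] \<eta>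
    unfolding E_def by (auto simp: norm_eq_1)
  have cj: "c j \<in> C" if "j \<in> J" for j unfolding c_def using CI a(1) b(1) wE(1) that by blast
  have touch: "x \<bullet> w j \<le> c j \<bullet> w j" if j: "j \<in> J" and x: "x \<in> C" for j x
  proof -
    obtain u y z where u: "u \<in> K0" "y \<in> K1" "z \<in> E" "x = u + y + z" using CE[OF x] by blast
    show ?thesis unfolding u(4) c_def inner_add_left
      using a(2)[OF j u(1)] b(2)[OF j u(2)] wE(2)[OF j u(3)] wE(3)[OF j] by simp
  qed
  obtain I where I: "I \<subseteq> J"
    "\<And>j. j \<in> J \<Longrightarrow> \<exists>i\<in>I. cap C (c j) (w j) \<delta> \<subseteq> cap C (c i) (w i) (\<kappa> * \<delta>)"
    "(\<Sum>i\<in>I. measure lebesgue (cap C (c i) (w i) \<delta>))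
      \<le> 2 ^ d * measure lebesgue (\<Union>j\<in>J. cap C (c j) (w j) \<delta>)"
    unfolding \<kappa>_def d_def
    by (rule economic_cap_covering[OF cC J less_imp_le[OF \<delta>(1)], of c w]) (use cj touch in blast)+
  have fI: "finite I" using I(1) J finite_subset by blast
  obtain \<iota> where \<iota>: "\<And>j. j \<in> J \<Longrightarrow> \<iota> j \<in> I"
    "\<And>j. j \<in> J \<Longrightarrow> cap C (c j) (w j) \<delta> \<subseteq> cap C (c (\<iota> j)) (w (\<iota> j)) (\<kappa> * \<delta>)"
    using I(2) by metis
  \<comment> \<open>The pairs assigned to one chosen cap are bounded by the volume of that cap.\<close>
  have group: "real (card {j \<in> J. \<iota> j = i}) * (unit_ball_vol d / (3 * 4 ^ d) * \<eta> ^ (d + 1))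
      \<le> real d ^ d * ((3 * \<kappa>) ^ d * measure lebesgue (cap C (c i) (w i) \<delta>))" if i: "i \<in> I" for i
  proof -
    define Ji where "Ji = {j \<in> J. \<iota> j = i}"
    have iJ: "i \<in> J" using i I by auto
    define A where "A = cap K0 (a i) (w i) (\<kappa> * \<delta>)"
    define B where "B = cap K1 (b i) (w i) (\<kappa> * \<delta>)"
    define G where "G = cap E (w i) (w i) (\<kappa> * \<delta>)"
    \<comment> \<open>The depth of \<open>c j\<close> in \<open>C\<close> is the sum of the nonnegative depths of its three summands.\<close>
    have mem: "a j \<in> A \<and> b j \<in> B \<and> w j \<in> G" if "j \<in> Ji" for j
    proof -
      have j: "j \<in> J" "\<iota> j = i" using that unfolding Ji_def by auto
      have "c j \<in> cap C (c j) (w j) \<delta>" unfolding cap_def using cj[OF j(1)] \<delta> by simp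
      then have "(c i - c j) \<bullet> w i \<le> \<kappa> * \<delta>" using \<iota>(2)[OF j(1)] j(2) unfolding cap_def by auto
      then have "(a i - a j) \<bullet> w i + (b i - b j) \<bullet> w i + (w i - w j) \<bullet> w i \<le> \<kappa> * \<delta>"
        unfolding c_def by (simp add: inner_diff_left inner_add_left)
      moreover have "(a i - a j) \<bullet> w i \<ge> 0" "(b i - b j) \<bullet> w i \<ge> 0" "(w i - w j) \<bullet> w i \<ge> 0"
        using a(2)[OF iJ a(1)[OF j(1)]] b(2)[OF iJ b(1)[OF j(1)]] wE(2)[OF iJ wE(1)[OF j(1)]] wE(3)[OF iJ]
        by (simp_all add: inner_diff_left)
      ultimately show ?thesis
        unfolding A_def B_def G_def cap_def using a(1) b(1) wE(1) j(1) by auto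
    qed
    have small: "norm (x - w i) \<le> \<rho>" if "x \<in> G" for x
    proof -
      have "norm (x - w i) \<le> sqrt (2 * (\<kappa> * \<delta>)) + \<eta>"
        using norm_diff_cylinder_cap_le[OF e1] w[OF iJ] that unfolding G_def E_def by blast
      also have "sqrt (2 * (\<kappa> * \<delta>)) = sqrt (2 * \<kappa>) * \<eta>"
        unfolding \<delta>_def using \<eta> by (simp add: real_sqrt_mult)
      finally show ?thesis unfolding \<rho>_def by (simp add: algebra_simps)
    qed
    have diamG: "norm (x - y) \<le> 2 * \<rho>" if "x \<in> G" "y \<in> G" for x y
      using norm_triangle_ineq4[of "x - w i" "y - w i"] small[OF that(1)] small[OF that(2)] by simp
    have disj: "disjoint_family_on (\<lambda>j. (+) (b j - a j) ` G) Ji"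
      unfolding disjoint_family_on_def
    proof (intro ballI impI)
      fix j k assume jk: "j \<in> Ji" "k \<in> Ji" "j \<noteq> k"
      have "norm (w j - w k) \<le> 2 * \<rho>" using mem jk diamG by blast
      moreover have "2 * (sqrt (2 * \<kappa>) + 1) * \<eta> = 2 * \<rho>" unfolding \<rho>_def by (rule mult.assoc)
      ultimately have far: "norm ((b j - a j) - (b k - a k)) > 2 * \<rho>"
        using sep[of j k] jk unfolding Ji_def by simp
      have False if "x \<in> G" "y \<in> G" "b j - a j + x = b k - a k + y" for x y
      proof -
        have "(b j - a j) - (b k - a k) = y - x" using that(3) by (simp add: algebra_simps)
        then show False using far diamG[OF that(2,1)] by simp
      qed
      then show "(+) (b j - a j) ` G \<inter> (+) (b k - a k) ` G = {}" by blast
    qed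
    have "cap E (w i) (w i) \<delta> \<subseteq> G" unfolding G_def cap_def using \<delta>(3) by auto
    then have "measure lebesgue (cap E (w i) (w i) \<delta>) \<le> measure lebesgue G"
      by (rule measure_mono_fmeasurable)
         (auto simp: G_def intro!: fmeasurableD lmeasurable_compact compact_cap cE)
    then have "unit_ball_vol d / (3 * 4 ^ d) * \<eta> ^ (d + 1) \<le> measure lebesgue G"
      using measure_cylinder_cap_ge[OF e1 _ _ \<eta>, of "w i"] w[OF iJ] unfolding E_def d_def \<delta>_def by simp
    then have "real (card Ji) * (unit_ball_vol d / (3 * 4 ^ d) * \<eta> ^ (d + 1)) \<le> real (card Ji) * measure lebesgue G"
      by (rule mult_left_mono) simp
    also have "\<dots> \<le> real d ^ d * measure lebesgue (cap C (c i) (w i) (3 * \<kappa> * \<delta>))"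
      unfolding d_def
    proof (rule card_disjoint_translates_le[OF _ _ _ _ _ _ _ _ _ _ _ disj])
      show "compact A" "convex A" "convex B" "compact G" "convex G"
        unfolding A_def B_def G_def by (intro compact_cap convex_cap K0 K1 cE)+
      show "G \<noteq> {}" using wE[OF iJ] \<delta> unfolding G_def cap_def by auto
      show "compact (cap C (c i) (w i) (3 * \<kappa> * \<delta>))" by (rule compact_cap[OF cC(1)])
      show "finite Ji" unfolding Ji_def using J by simp
      show "a j \<in> A" "b j \<in> B" if "j \<in> Ji" for j using mem[OF that] by auto
      fix x y z assume "x \<in> A" "y \<in> B" "z \<in> G"
      then have *: "x \<in> K0" "y \<in> K1" "z \<in> E" "(a i - x) \<bullet> w i \<le> \<kappa> * \<delta>"
          "(b i - y) \<bullet> w i \<le> \<kappa> * \<delta>" "(w i - z) \<bullet> w i \<le> \<kappa> * \<delta>"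
        unfolding A_def B_def G_def cap_def by auto
      have "(c i - (x + y + z)) \<bullet> w i = (a i - x) \<bullet> w i + (b i - y) \<bullet> w i + (w i - z) \<bullet> w i"
        unfolding c_def by (simp add: inner_diff_left inner_add_left)
      then show "x + y + z \<in> cap C (c i) (w i) (3 * \<kappa> * \<delta>)"
        unfolding cap_def using * CI by simp
    qed
    also have "\<dots> \<le> real d ^ d * ((3 * \<kappa>) ^ d * measure lebesgue (cap C (c i) (w i) \<delta>))"
      using measure_cap_mult_le[OF cC cj[OF iJ], of "3 * \<kappa>" "w i" \<delta>] \<kappa> unfolding d_def
      by (intro mult_left_mono) auto
    finally show ?thesis unfolding Ji_def .
  qed
  obtain j0 where j0: "j0 \<in> J" using False by auto
  \<comment> \<open>The cylinder contains the unit disc, so any point of \<open>K0 + K1\<close> has depth at least 1 in \<open>C\<close>.\<close>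
  define p where "p = a j0 + b j0"
  have caps: "measure lebesgue (\<Union>j\<in>J. cap C (c j) (w j) \<delta>) \<le> 2 * d * \<delta> * measure lebesgue C"
    unfolding d_def
  proof (rule measure_caps_le[OF cC J \<delta>(1,2)])
    have "0 \<in> E" unfolding E_def cylinder_def using \<eta> by simp
    then show "p \<in> C" unfolding p_def using CI[OF a(1)[OF j0] b(1)[OF j0]] by fastforce
    show "(c j - p) \<bullet> w j \<ge> 1" if j: "j \<in> J" for j
      using a(2)[OF j a(1)[OF j0]] b(2)[OF j b(1)[OF j0]] wE(3)[OF j] unfolding c_def p_def
      by (simp add: inner_diff_left inner_add_left)
  qed (use touch in auto)
  have volC: "measure lebesgue C \<le> 2 * \<eta> * (2 * (2 * R + 2)) ^ (d - 1)"
    unfolding d_def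
  proof (rule measure_slab_le[OF cC(1) e])
    fix v assume "v \<in> C"
    then obtain x y z where v: "x \<in> K0" "y \<in> K1" "z \<in> E" "v = x + y + z" using CE by blast
    have "norm v \<le> norm x + norm y + norm z" unfolding v(4)
      using norm_triangle_ineq[of "x + y" z] norm_triangle_ineq[of x y] by linarith
    moreover have "norm z \<le> 1 + \<eta>" using norm_cylinder_le[OF e1] v(3) unfolding E_def by blast
    moreover have "\<bar>z \<bullet> e\<bar> \<le> \<eta>" using v(3) unfolding E_def cylinder_def by simp
    ultimately show "norm v \<le> 2 * R + 2 \<and> \<bar>v \<bullet> e - (q0 + q1)\<bar> \<le> \<eta>"
      using K0(3)[OF v(1)] K1(3)[OF v(2)] \<eta> unfolding v(4) by (auto simp: inner_add_left)
  qed (use R \<eta> in auto)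
  have "real (card J) * (unit_ball_vol d / (3 * 4 ^ d) * \<eta> ^ (d + 1))
      = (\<Sum>i\<in>I. real (card {j \<in> J. \<iota> j = i}) * (unit_ball_vol d / (3 * 4 ^ d) * \<eta> ^ (d + 1)))"
  proof -
    have "(\<Sum>i\<in>I. \<Sum>j\<in>{j \<in> J. \<iota> j = i}. 1::real) = (\<Sum>j\<in>J. 1)"
      by (rule sum.group[OF J fI]) (use \<iota> in auto)
    then have "(\<Sum>i\<in>I. real (card {j \<in> J. \<iota> j = i})) = real (card J)" by simp
    then show ?thesis by (simp only: sum_distrib_right[symmetric])
  qed
  also have "\<dots> \<le> (\<Sum>i\<in>I. real d ^ d * ((3 * \<kappa>) ^ d * measure lebesgue (cap C (c i) (w i) \<delta>)))"
    by (intro sum_mono group)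
  also have "\<dots> = real d ^ d * (3 * \<kappa>) ^ d * (\<Sum>i\<in>I. measure lebesgue (cap C (c i) (w i) \<delta>))"
    by (simp add: sum_distrib_left mult.assoc)
  also have "\<dots> \<le> real d ^ d * (3 * \<kappa>) ^ d * (2 ^ d * (2 * d * \<delta> * (2 * \<eta> * (2 * (2 * R + 2)) ^ (d - 1))))"
  proof -
    have "measure lebesgue (\<Union>j\<in>J. cap C (c j) (w j) \<delta>) \<le> 2 * d * \<delta> * (2 * \<eta> * (2 * (2 * R + 2)) ^ (d - 1))"
      by (rule order.trans[OF caps mult_left_mono[OF volC]]) (use \<delta>(1) in auto)
    then have "2 ^ d * measure lebesgue (\<Union>j\<in>J. cap C (c j) (w j) \<delta>)
        \<le> 2 ^ d * (2 * d * \<delta> * (2 * \<eta> * (2 * (2 * R + 2)) ^ (d - 1)))"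
      by (intro mult_left_mono) auto
    from order.trans[OF I(3) this] show ?thesis by (rule mult_left_mono) (use \<kappa> in auto)
  qed
  also have "\<dots> = (6 * \<kappa> * d) ^ d * 4 * d * (4 * R + 4) ^ (d - 1) * \<eta> ^ 3"
  proof -
    have "6 * \<kappa> * d = real d * (3 * \<kappa>) * 2" by simp
    then have 1: "(6 * \<kappa> * d) ^ d = real d ^ d * (3 * \<kappa>) ^ d * 2 ^ d"
      by (simp only: power_mult_distrib)
    have 2: "\<eta> ^ 3 = \<delta> * \<eta>" unfolding \<delta>_def by (simp add: power2_eq_square power3_eq_cube)
    have 3: "2 * (2 * R + 2) = 4 * R + 4" by simp
    have "x * (y * (2 * z * \<delta> * (2 * \<eta> * u))) = x * y * 4 * z * u * (\<delta> * \<eta>)" for x y z u :: real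
      by simp
    then show ?thesis unfolding 1 2 3 by simp
  qed
  finally show ?thesis unfolding d_def .
qed

section \<open>Directions and normals of boundary segments\<close>

lemma norm_normalize_diff_le:
  fixes x y :: "'a::real_normed_vector"
  assumes "x \<noteq> 0" "y \<noteq> 0"
  shows "norm (x /\<^sub>R norm x - y /\<^sub>R norm y) \<le> 2 * norm (x - y) / norm x"
proof -
  have "x /\<^sub>R norm x - y /\<^sub>R norm y = (x - y) /\<^sub>R norm x + (1 / norm x - 1 / norm y) *\<^sub>R y"
    by (simp add: algebra_simps divide_inverse)
  also have "norm \<dots> \<le> norm ((x - y) /\<^sub>R norm x) + norm ((1 / norm x - 1 / norm y) *\<^sub>R y)"
    by (rule norm_triangle_ineq)
  also have "norm ((x - y) /\<^sub>R norm x) = norm (x - y) / norm x" by (simp add: divide_inverse mult.commute)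
  also have "norm ((1 / norm x - 1 / norm y) *\<^sub>R y) = \<bar>norm y - norm x\<bar> / norm x"
  proof -
    have "1 / norm x - 1 / norm y = (norm y - norm x) / (norm x * norm y)" using assms by (simp add: field_simps)
    then show ?thesis using assms by (simp add: abs_mult)
  qed
  also have "\<bar>norm y - norm x\<bar> / norm x \<le> norm (x - y) / norm x"
    using norm_triangle_ineq3[of y x] by (intro divide_right_mono) (auto simp: norm_minus_commute)
  finally show ?thesis by simp
qed

text \<open>The pairs (direction, normal) witnessed by two points of a common supporting hyperplane that
lie in prescribed parallel slices of \<open>K\<close> and in a fixed ball.\<close>

definition crossing_pairs :: "'a::euclidean_space set \<Rightarrow> 'a \<Rightarrow> real \<Rightarrow> real \<Rightarrow> real \<Rightarrow> ('a \<times> 'a) set" where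
  "crossing_pairs K e p q R = {((b - a) /\<^sub>R norm (b - a), \<omega>) | a b \<omega>.
     a \<in> K \<and> b \<in> K \<and> a \<bullet> e = p \<and> b \<bullet> e = q \<and> norm a \<le> R \<and> norm b \<le> R \<and>
     norm \<omega> = 1 \<and> (b - a) \<bullet> \<omega> = 0 \<and> (\<forall>x\<in>K. x \<bullet> \<omega> \<le> a \<bullet> \<omega>)}"

text \<open>Passing from the normal \<open>\<omega>\<close> to the direction \<open>w\<close> of its projection orthogonal to \<open>e\<close> loses nothing: as \<open>\<omega>\<close>
is orthogonal to \<open>u\<close> and \<open>u \<bullet> e \<noteq> 0\<close>, its component along \<open>e\<close> can be solved for.  The bound
\<open>norm y \<ge> 1\<close> makes the normalisation Lipschitz.\<close>

lemma normal_eq_normalize: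
  fixes e u \<omega> :: "'a::euclidean_space"
  assumes e: "norm e = 1" and h: "u \<bullet> e = h" "h \<noteq> 0" and \<omega>: "norm \<omega> = 1" "u \<bullet> \<omega> = 0"
  defines "w \<equiv> (\<omega> - (\<omega> \<bullet> e) *\<^sub>R e) /\<^sub>R norm (\<omega> - (\<omega> \<bullet> e) *\<^sub>R e)"
  defines "y \<equiv> w - ((w \<bullet> u) / h) *\<^sub>R e"
  shows "norm w = 1" "w \<bullet> e = 0" "norm y \<ge> 1" "\<omega> = y /\<^sub>R norm y" "\<omega> - (\<omega> \<bullet> e) *\<^sub>R e \<noteq> 0"
proof -
  define s where "s = norm (\<omega> - (\<omega> \<bullet> e) *\<^sub>R e)"
  have ee: "e \<bullet> e = 1" using e by (simp add: norm_eq_1)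
  show nz: "\<omega> - (\<omega> \<bullet> e) *\<^sub>R e \<noteq> 0"
  proof
    assume "\<omega> - (\<omega> \<bullet> e) *\<^sub>R e = 0"
    then have eq: "\<omega> = (\<omega> \<bullet> e) *\<^sub>R e" by simp
    then have "u \<bullet> \<omega> = (\<omega> \<bullet> e) * h" using h by (metis inner_scaleR_right)
    then have "\<omega> \<bullet> e = 0" using \<omega> h by simp
    then show False using eq \<omega> by simp
  qed
  then have s: "s > 0" unfolding s_def by simp
  have w: "w = (1/s) *\<^sub>R \<omega> - ((\<omega> \<bullet> e) / s) *\<^sub>R e"
    unfolding w_def s_def[symmetric] by (simp add: algebra_simps divide_inverse)
  show w1: "norm w = 1" unfolding w_def using nz by simp
  show we: "w \<bullet> e = 0" unfolding w using ee by (simp add: inner_diff_left)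
  have "w \<bullet> u = - ((\<omega> \<bullet> e) / s) * h"
    unfolding w using h \<omega> by (simp add: inner_diff_left inner_commute[of \<omega> u] inner_commute[of e u])
  then have y: "y = (1/s) *\<^sub>R \<omega>" unfolding y_def using h(2) unfolding w by simp
  have "norm y = 1 / s" unfolding y using s \<omega> by simp
  then show "\<omega> = y /\<^sub>R norm y" unfolding y using s by simp
  have "1 = y \<bullet> w" unfolding y_def using w1 we by (simp add: inner_diff_left norm_eq_1 inner_commute[of e w])
  also have "\<dots> \<le> norm y * norm w" by (rule norm_cauchy_schwarz)
  finally show "norm y \<ge> 1" using w1 by simp
qed

text \<open>The pair \<open>(v, \<omega>)\<close> is a Lipschitz function of \<open>(b - a, w)\<close>, so separated pairs in
\<open>crossing_pairs\<close> come from separated pairs of the latter kind, which have been counted.  The lemma is stated for subsets because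
the countable decomposition of \<open>T_K\<close> uses the parts of these sets inside \<open>T_K\<close>.\<close>

lemma finite_minkowski_content_crossing_pairs:
  fixes K :: "'a::euclidean_space set"
  assumes K: "closed K" "convex K" and e: "e \<in> Basis" and pq: "p \<noteq> q" and R: "R \<ge> 0"
    and S: "S \<subseteq> crossing_pairs K e p q R"
  shows "finite_minkowski_content (real DIM('a) - 2) S"
proof -
  define d where "d = DIM('a)"
  define h where "h = q - p"
  define \<kappa> where "\<kappa> = 2 * (real DIM('a) + 1)"
  define c where "c = 2 * (sqrt (2 * \<kappa>) + 1)"
  define L where "L = 2 / \<bar>h\<bar> + 2 * (1 + (2 * R + 1) / \<bar>h\<bar>)"
  define g where "g = unit_ball_vol d / (3 * 4 ^ d)"
  define M where "M = (6 * \<kappa> * d) ^ d * 4 * d * (4 * R + 4) ^ (d - 1)"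
  define K0 where "K0 = K \<inter> {x. e \<bullet> x = p} \<inter> cball 0 R"
  define K1 where "K1 = K \<inter> {x. e \<bullet> x = q} \<inter> cball 0 R"
  have h: "h \<noteq> 0" unfolding h_def using pq by simp
  have e1: "norm e = 1" using e by simp
  have c: "c > 0" unfolding c_def \<kappa>_def by (simp add: add_nonneg_pos)
  have L: "L > 0" unfolding L_def using h R by (simp add: add_pos_nonneg)
  have g: "g > 0" unfolding g_def by (simp add: unit_ball_vol_pos)
  have cK: "compact K0" "compact K1" unfolding K0_def K1_def
    by (auto intro!: closed_Int_compact closed_Int closed_hyperplane K)
  have vK: "convex K0" "convex K1" unfolding K0_def K1_def
    by (auto intro!: convex_Int convex_hyperplane K)
  show ?thesis
  proof (rule finite_minkowski_content_if_separated_sets_bounded[of "c * L" "1/2"])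
    show "c * L > 0" using c L by simp
    fix \<epsilon> F
    assume \<epsilon>: "0 < \<epsilon>" "\<epsilon> < 1/2" and F: "finite F" "F \<subseteq> S"
      and sep: "pairwise (\<lambda>x y. c * L * \<epsilon> < dist x y) F"
    have "\<forall>t\<in>F. \<exists>a b. fst t = (b - a) /\<^sub>R norm (b - a) \<and> a \<in> K \<and> b \<in> K \<and> a \<bullet> e = p \<and> b \<bullet> e = q \<and>
       norm a \<le> R \<and> norm b \<le> R \<and> norm (snd t) = 1 \<and> (b - a) \<bullet> snd t = 0 \<and>
       (\<forall>x\<in>K. x \<bullet> snd t \<le> a \<bullet> snd t)"
      using F(2) S unfolding crossing_pairs_def by fastforce
    then obtain a b where "\<forall>t\<in>F. fst t = (b t - a t) /\<^sub>R norm (b t - a t) \<and> a t \<in> K \<and> b t \<in> K \<and>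
       a t \<bullet> e = p \<and> b t \<bullet> e = q \<and> norm (a t) \<le> R \<and> norm (b t) \<le> R \<and> norm (snd t) = 1 \<and>
       (b t - a t) \<bullet> snd t = 0 \<and> (\<forall>x\<in>K. x \<bullet> snd t \<le> a t \<bullet> snd t)"
      unfolding bchoice_iff by blast
    then have ab: "\<And>t. t \<in> F \<Longrightarrow> fst t = (b t - a t) /\<^sub>R norm (b t - a t)"
      "\<And>t. t \<in> F \<Longrightarrow> a t \<in> K" "\<And>t. t \<in> F \<Longrightarrow> b t \<in> K"
      "\<And>t. t \<in> F \<Longrightarrow> a t \<bullet> e = p" "\<And>t. t \<in> F \<Longrightarrow> b t \<bullet> e = q"
      "\<And>t. t \<in> F \<Longrightarrow> norm (a t) \<le> R" "\<And>t. t \<in> F \<Longrightarrow> norm (b t) \<le> R"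
      "\<And>t. t \<in> F \<Longrightarrow> norm (snd t) = 1" "\<And>t. t \<in> F \<Longrightarrow> (b t - a t) \<bullet> snd t = 0"
      "\<And>t x. t \<in> F \<Longrightarrow> x \<in> K \<Longrightarrow> x \<bullet> snd t \<le> a t \<bullet> snd t"
      by blast+
    define u where "u t = b t - a t" for t
    define P where "P t = snd t - (snd t \<bullet> e) *\<^sub>R e" for t :: "'a \<times> 'a"
    define w where "w t = P t /\<^sub>R norm (P t)" for t
    define y where "y t = w t - ((w t \<bullet> u t) / h) *\<^sub>R e" for t
    have uh: "u t \<bullet> e = h" if "t \<in> F" for t
      unfolding u_def h_def using ab(4,5)[OF that] by (simp add: inner_diff_left)
    have w: "norm (w t) = 1" "w t \<bullet> e = 0" "norm (y t) \<ge> 1" "snd t = y t /\<^sub>R norm (y t)" "P t \<noteq> 0"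
      if t: "t \<in> F" for t
      using normal_eq_normalize[OF e1 uh[OF t] h ab(8)[OF t], folded P_def, folded w_def, folded y_def] ab(9)[OF t]
      unfolding u_def[symmetric] by auto
    have nu: "norm (u t) \<ge> \<bar>h\<bar>" if "t \<in> F" for t
      using Basis_le_norm[OF e, of "u t"] uh[OF that] by simp
    \<comment> \<open>Within a slice orthogonal to \<open>e\<close>, the normal and its projection order points alike.\<close>
    have wmono: "x \<bullet> w t \<le> z \<bullet> w t" if "t \<in> F" "x \<bullet> e = z \<bullet> e" "x \<bullet> snd t \<le> z \<bullet> snd t" for t x z
    proof -
      have "(z - x) \<bullet> P t = (z - x) \<bullet> snd t" unfolding P_def using that(2)
        by (simp add: inner_diff_left inner_diff_right)
      then have "(z - x) \<bullet> w t \<ge> 0" unfolding w_def using that(3)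
        by (simp add: inner_diff_left mult_left_mono)
      then show ?thesis by (simp add: inner_diff_left)
    qed
    have Lip: "dist s t \<le> c * L * \<epsilon>"
      if st: "s \<in> F" "t \<in> F" and du: "norm (u s - u t) \<le> c * \<epsilon>" and dw: "norm (w s - w t) \<le> c * \<epsilon>" for s t
    proof -
      have "u s \<noteq> 0" "u t \<noteq> 0" using nu[OF st(1)] nu[OF st(2)] h by auto
      then have "norm (fst s - fst t) \<le> 2 * norm (u s - u t) / norm (u s)"
        unfolding ab(1)[OF st(1)] ab(1)[OF st(2)] u_def[symmetric] by (rule norm_normalize_diff_le)
      also have "\<dots> \<le> 2 * (c * \<epsilon>) / \<bar>h\<bar>"
        using du nu[OF st(1)] h c \<epsilon> by (intro frac_le) auto
      finally have 1: "norm (fst s - fst t) \<le> c * \<epsilon> * (2 / \<bar>h\<bar>)" by (simp add: mult_ac)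
      have "w s \<bullet> u s - w t \<bullet> u t = (w s - w t) \<bullet> u s + w t \<bullet> (u s - u t)"
        by (simp add: inner_diff_left inner_diff_right)
      also have "\<bar>\<dots>\<bar> \<le> \<bar>(w s - w t) \<bullet> u s\<bar> + \<bar>w t \<bullet> (u s - u t)\<bar>" by (rule abs_triangle_ineq)
      also have "\<dots> \<le> norm (w s - w t) * norm (u s) + norm (w t) * norm (u s - u t)"
        by (intro add_mono Cauchy_Schwarz_ineq2)
      also have "\<dots> \<le> (c * \<epsilon>) * (2 * R) + 1 * (c * \<epsilon>)"
      proof (intro add_mono mult_mono dw du)
        show "norm (u s) \<le> 2 * R"
          using norm_triangle_ineq4[of "b s" "a s"] ab(6,7)[OF st(1)] unfolding u_def by simp
      qed (use w(1)[OF st(2)] c \<epsilon> in auto)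
      finally have wu: "\<bar>w s \<bullet> u s - w t \<bullet> u t\<bar> \<le> c * \<epsilon> * (2 * R + 1)" by (simp add: algebra_simps)
      have "y s - y t = (w s - w t) - ((w s \<bullet> u s - w t \<bullet> u t) / h) *\<^sub>R e"
        unfolding y_def by (simp add: algebra_simps diff_divide_distrib)
      also have "norm \<dots> \<le> norm (w s - w t) + \<bar>w s \<bullet> u s - w t \<bullet> u t\<bar> / \<bar>h\<bar>"
        using norm_triangle_ineq4[of "w s - w t" "((w s \<bullet> u s - w t \<bullet> u t) / h) *\<^sub>R e"] e1 by simp
      also have "\<dots> \<le> c * \<epsilon> + c * \<epsilon> * (2 * R + 1) / \<bar>h\<bar>"
        using dw wu by (intro add_mono divide_right_mono) auto
      also have "\<dots> = c * \<epsilon> * (1 + (2 * R + 1) / \<bar>h\<bar>)" by (simp add: algebra_simps)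
      finally have dy: "norm (y s - y t) \<le> c * \<epsilon> * (1 + (2 * R + 1) / \<bar>h\<bar>)" .
      have "norm (snd s - snd t) \<le> 2 * norm (y s - y t) / norm (y s)"
      proof -
        have "y s \<noteq> 0" "y t \<noteq> 0" using w(3)[OF st(1)] w(3)[OF st(2)] by auto
        then have "norm (y s /\<^sub>R norm (y s) - y t /\<^sub>R norm (y t)) \<le> 2 * norm (y s - y t) / norm (y s)"
          by (rule norm_normalize_diff_le)
        then show ?thesis by (simp only: w(4)[OF st(1), symmetric] w(4)[OF st(2), symmetric])
      qed
      also have "\<dots> \<le> 2 * (c * \<epsilon> * (1 + (2 * R + 1) / \<bar>h\<bar>)) / 1"
        using dy w(3)[OF st(1)] c \<epsilon> R by (intro frac_le) auto
      finally have 2: "norm (snd s - snd t) \<le> c * \<epsilon> * (2 * (1 + (2 * R + 1) / \<bar>h\<bar>))" by (simp only: mult_ac div_by_1)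
      have "dist s t \<le> norm (fst s - fst t) + norm (snd s - snd t)"
        unfolding dist_prod_def dist_norm by (rule sqrt_sum_squares_le_sum) auto
      also have "\<dots> \<le> c * \<epsilon> * (2 / \<bar>h\<bar>) + c * \<epsilon> * (2 * (1 + (2 * R + 1) / \<bar>h\<bar>))"
        using 1 2 by (rule add_mono)
      also have "\<dots> = c * \<epsilon> * L" unfolding L_def by (rule distrib_left[symmetric])
      also have "\<dots> = c * L * \<epsilon>" by (simp only: mult_ac)
      finally show ?thesis .
    qed
    have "real (card F) * (g * \<epsilon> ^ (d + 1)) \<le> M * \<epsilon> ^ 3"
      unfolding g_def M_def d_def \<kappa>_def
    proof (rule card_separated_touching_pairs_le[where a = a and b = b and w = w, OF e R cK(1) vK(1) _ cK(2) vK(2)])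
      show "norm x \<le> R \<and> x \<bullet> e = p" if "x \<in> K0" for x
        using that unfolding K0_def by (simp add: inner_commute)
      show "norm x \<le> R \<and> x \<bullet> e = q" if "x \<in> K1" for x
        using that unfolding K1_def by (simp add: inner_commute)
      show "a t \<in> K0" "b t \<in> K1" if "t \<in> F" for t
        using ab(2-7)[OF that] unfolding K0_def K1_def by (simp_all add: inner_commute)
      show "x \<bullet> w t \<le> a t \<bullet> w t" if "t \<in> F" "x \<in> K0" for t x
        using that ab(4,10) by (intro wmono) (auto simp: K0_def inner_commute)
      show "x \<bullet> w t \<le> b t \<bullet> w t" if t: "t \<in> F" "x \<in> K1" for t x
        using that ab(5)[OF t(1)] ab(9)[OF t(1)] ab(10)[OF t(1), of x]
        by (intro wmono) (auto simp: K1_def inner_commute[of e] inner_diff_left)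
      fix s t assume st: "s \<in> F" "t \<in> F" "s \<noteq> t"
        and dw: "norm (w s - w t) \<le> 2 * (sqrt (2 * (2 * (real DIM('a) + 1))) + 1) * \<epsilon>"
      have "\<not> dist s t \<le> c * L * \<epsilon>" using sep st unfolding pairwise_def by force
      then have "norm (u s - u t) > c * \<epsilon>" using Lip[OF st(1,2)] dw unfolding c_def \<kappa>_def by force
      then show "norm (b s - a s - (b t - a t)) > 2 * (sqrt (2 * (2 * (real DIM('a) + 1))) + 1) * \<epsilon>"
        unfolding u_def c_def \<kappa>_def .
    qed (use \<epsilon> F w in auto)
    moreover have "\<epsilon> ^ (d + 1) = \<epsilon> powr (real d - 2) * \<epsilon> ^ 3"
    proof -
      have "\<epsilon> ^ (d + 1) = \<epsilon> powr real (d + 1)" by (rule powr_realpow[OF \<epsilon>(1), symmetric])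
      also have "\<dots> = \<epsilon> powr ((real d - 2) + 3)" by (rule arg_cong[of _ _ "(powr) \<epsilon>"]) simp
      also have "\<dots> = \<epsilon> powr (real d - 2) * \<epsilon> powr 3" by (rule powr_add)
      also have "\<epsilon> powr 3 = \<epsilon> ^ 3" using \<epsilon> by simp
      finally show ?thesis .
    qed
    ultimately have "real (card F) * (g * (\<epsilon> powr (real d - 2) * \<epsilon> ^ 3)) \<le> M * \<epsilon> ^ 3"
      by (simp only:)
    then have "(g * (real (card F) * \<epsilon> powr (real d - 2))) * \<epsilon> ^ 3 \<le> M * \<epsilon> ^ 3"
      by (simp only: mult_ac)
    then have "g * (real (card F) * \<epsilon> powr (real d - 2)) \<le> M" using \<epsilon> by simp
    then show "real (card F) * \<epsilon> powr (real DIM('a) - 2) \<le> M / g"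
      using g unfolding d_def[symmetric] by (simp add: field_simps)
  qed simp
qed

text \<open>Some coordinate is not constant along the segment; two rational values that it takes there, in
the order from \<open>a\<close> to \<open>b\<close>, give crossing points with the same direction.\<close>

lemma boundary_segment_pair_crosses:
  fixes K :: "'a::euclidean_space set"
  assumes K: "closed K" and vw: "(v, w) \<in> boundary_segment_pairs K"
  obtains e p q n where "e \<in> Basis" "p \<in> \<rat>" "q \<in> \<rat>" "p \<noteq> q" "(v, w) \<in> crossing_pairs K e p q (real n)"
proof -
  obtain a b h where ab: "a \<noteq> b" "v = (b - a) /\<^sub>R norm (b - a)" "closed_segment a b \<subseteq> frontier K"
    and w: "norm w = 1" and H: "K \<subseteq> {x. w \<bullet> x \<le> h}" "closed_segment a b \<subseteq> {x. w \<bullet> x = h}"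
    using vw unfolding boundary_segment_pairs_def supporting_hyperplane_def segment_direction_def by auto
  have segK: "closed_segment a b \<subseteq> K" using ab(3) frontier_subset_closed[OF K] by blast
  obtain e where e: "e \<in> Basis" "a \<bullet> e \<noteq> b \<bullet> e" using ab(1) euclidean_eqI by blast
  define l where "l = b \<bullet> e - a \<bullet> e"
  have l: "l \<noteq> 0" unfolding l_def using e by simp
  obtain p q where pq: "p \<in> \<rat>" "q \<in> \<rat>" "0 \<le> (p - a \<bullet> e) / l" "(p - a \<bullet> e) / l < (q - a \<bullet> e) / l"
      "(q - a \<bullet> e) / l \<le> 1"
  proof (cases "l > 0")
    case True
    then have "a \<bullet> e < b \<bullet> e" unfolding l_def by simp
    then obtain p where p: "p \<in> \<rat>" "a \<bullet> e < p" "p < b \<bullet> e" using Rats_dense_in_real by blast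
    then obtain q where q: "q \<in> \<rat>" "p < q" "q < b \<bullet> e" using Rats_dense_in_real by blast
    show ?thesis by (rule that[OF p(1) q(1)]) (use p q True in \<open>auto simp: l_def divide_simps\<close>)
  next
    case False
    then have "b \<bullet> e < a \<bullet> e" using l unfolding l_def by simp
    then obtain p where p: "p \<in> \<rat>" "b \<bullet> e < p" "p < a \<bullet> e" using Rats_dense_in_real by blast
    then obtain q where q: "q \<in> \<rat>" "b \<bullet> e < q" "q < p" using Rats_dense_in_real by blast
    show ?thesis by (rule that[OF p(1) q(1)]) (use p q False l in \<open>auto simp: l_def divide_simps\<close>)
  qed
  define s t where "s = (p - a \<bullet> e) / l" and "t = (q - a \<bullet> e) / l"
  have st: "0 \<le> s" "s < t" "t \<le> 1" using pq unfolding s_def t_def by auto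
  define a' b' where "a' = a + s *\<^sub>R (b - a)" and "b' = a + t *\<^sub>R (b - a)"
  have "a' = (1 - s) *\<^sub>R a + s *\<^sub>R b" "b' = (1 - t) *\<^sub>R a + t *\<^sub>R b"
    unfolding a'_def b'_def by (simp_all add: algebra_simps)
  moreover have "s \<le> 1" "0 \<le> t" using st by auto
  ultimately have seg: "a' \<in> closed_segment a b" "b' \<in> closed_segment a b"
    using st unfolding in_segment by blast+
  have diff: "b' - a' = (t - s) *\<^sub>R (b - a)" unfolding a'_def b'_def by (simp add: algebra_simps)
  have v: "v = (b' - a') /\<^sub>R norm (b' - a')" unfolding diff ab(2) using st by simp
  have ae: "a' \<bullet> e = p" "b' \<bullet> e = q" unfolding a'_def b'_def s_def t_def using l
    by (simp_all add: inner_add_left inner_diff_left l_def[symmetric])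
  obtain n where n: "max (norm a') (norm b') \<le> real n" using real_arch_simple by blast
  have "(v, w) \<in> crossing_pairs K e p q (real n)"
    unfolding crossing_pairs_def
  proof (intro CollectI exI conjI)
    show "(v, w) = ((b' - a') /\<^sub>R norm (b' - a'), w)" using v by simp
    show "a' \<in> K" "b' \<in> K" using seg segK by auto
    have "w \<bullet> a' = h" "w \<bullet> b' = h" using seg H(2) by auto
    then show "(b' - a') \<bullet> w = 0" by (simp add: inner_commute[of _ w] inner_diff_right)
    show "\<forall>x\<in>K. x \<bullet> w \<le> a' \<bullet> w" using seg(1) H by (auto simp: inner_commute[of _ w])
  qed (use ae n w in auto)
  moreover have "p \<noteq> q" using pq by auto
  ultimately show ?thesis using that e(1) pq(1,2) by blast
qed

theorem theoremA:
  fixes K :: "(real ^ 'd) set"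
  assumes "closed K" and "convex K"
  shows "sigma_finite_minkowski_content (real CARD('d) - 2) (boundary_segment_pairs K)"
proof -
  define piece where "piece = (\<lambda>(e, p, q, n). boundary_segment_pairs K \<inter> crossing_pairs K e p q (real n))"
  define I where "I = {(e :: real ^ 'd, p :: real, q :: real, n :: nat). e \<in> Basis \<and> p \<in> \<rat> \<and> q \<in> \<rat> \<and> p \<noteq> q}"
  have "I \<subseteq> Basis \<times> \<rat> \<times> \<rat> \<times> UNIV" unfolding I_def by auto
  moreover have "countable (Basis \<times> \<rat> \<times> \<rat> \<times> (UNIV :: nat set) :: ((real ^ 'd) \<times> real \<times> real \<times> nat) set)"
    by (intro countable_SIGMA countable_rat) (auto intro: countable_finite)
  ultimately have "countable I" by (rule countable_subset)
  moreover have "finite_minkowski_content (real CARD('d) - 2) A" if A_piece: "A \<in> piece ` I" for A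
  proof -
    obtain x where "x \<in> I" "A = piece x" using A_piece by blast
    moreover obtain e p q n where "x = (e, p, q, n)" by (cases x)
    ultimately have epqn: "(e, p, q, n) \<in> I" and A: "A = piece (e, p, q, n)" by auto
    have *: "e \<in> Basis" "p \<noteq> q" "A \<subseteq> crossing_pairs K e p q (real n)"
      using epqn unfolding I_def A piece_def by auto
    then show ?thesis using finite_minkowski_content_crossing_pairs[OF assms *(1,2) _ *(3)] by simp
  qed
  moreover have "boundary_segment_pairs K = \<Union>(piece ` I)"
  proof
    show "\<Union>(piece ` I) \<subseteq> boundary_segment_pairs K" unfolding piece_def by auto
    show "boundary_segment_pairs K \<subseteq> \<Union>(piece ` I)"
    proof clarify
      fix v w assume vw: "(v, w) \<in> boundary_segment_pairs K"
      obtain e p q n where "e \<in> Basis" "p \<in> \<rat>" "q \<in> \<rat>" "p \<noteq> q" "(v, w) \<in> crossing_pairs K e p q (real n)"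
        using boundary_segment_pair_crosses[OF assms(1) vw] .
      then have "(e, p, q, n) \<in> I" "(v, w) \<in> piece (e, p, q, n)" using vw unfolding I_def piece_def by auto
      then show "(v, w) \<in> \<Union>(piece ` I)" by blast
    qed
  qed
  ultimately show ?thesis unfolding sigma_finite_minkowski_content_def
    by (intro exI[of _ "piece ` I"]) auto
qed

end
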